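(* Let $q$ be an odd prime power, $G=\mathrm{GL}(2,\mathbb F_q)$ and $C\le G$ the Cartan subgroup. Let $\nu_0,\nu\in\widehat{\mathbb F_{q^2}^*}$ be indecomposable and suppose that $\nu^\sharp=\nu_0^\sharp$ but $\nu,\overline\nu\neq\nu_0$. Then the spherical function of the multiplicity-free triple $(G,C,\nu_0)$ associated with the cuspidal representation $\rho_\nu$ is given, for all $x\in\mathbb F_q^*$, $y\in\mathbb F_q$, $(a,b)\in\mathbb F_q^2\setminus\{(0,0)\}$, by $$\phi^\nu\left[\begin{pmatrix} x & y \\ 0 & 1 \end{pmatrix}\begin{pmatrix} a & \eta b \\ b & a \end{pmatrix}\right]=-\frac{\overline{\nu_0(a+ib)}}{q+1}\sum_{z\in\mathbb F_q^*}\nu(-x^{-1}z)\chi(-yz^{-1})\sum_{\gamma\in\mathbb F_q}\overline{\nu_0(\gamma+i)}\,\chi(\gamma z^{-1}(x+1))\,j(xz^{-2}(\gamma^2-\eta))+\frac{\overline{\nu_0(a+ib)}}{q+1}\,\delta_{x,1}(q\delta_{y,0}-1).$$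
   Context: $\eta$ is a generator of $\mathbb F_q^*$, $\mathbb F_{q^2}=\mathbb F_q(i)$ with $i^2=\eta$, $\overline{\alpha+i\beta}=\alpha-i\beta$; for complex numbers (such as $\nu_0(z)$) the bar is complex conjugation. $C=\left\{\begin{pmatrix} a & \eta b \\ b & a \end{pmatrix}:(a,b)\ne(0,0)\right\}\cong\mathbb F_{q^2}^*$ via $\begin{pmatrix} a & \eta b \\ b & a \end{pmatrix}\mapsto a+ib$, so $\nu_0$ is regarded as a one-dimensional representation of $C$. Every element of $G$ is uniquely a product $\begin{pmatrix} x & y \\ 0 & 1 \end{pmatrix}\begin{pmatrix} a & \eta b \\ b & a \end{pmatrix}$. For $\nu\in\widehat{\mathbb F_{q^2}^*}$ (a multiplicative character): $\nu^\sharp=\nu|_{\mathbb F_q^*}$, $\overline\nu(w)=\nu(\overline w)$; $\nu$ is decomposable if $\nu(w)=\psi(w\overline w)$ for some $\psi\in\widehat{\mathbb F_q^*}$, otherwise indecomposable. $\chi$ is a fixed nontrivial additive character of $\mathbb F_q$ and $j(x)=\frac1q\sum_{w\in\mathbb F_{q^2}^*,\,w\overline w=x}\chi(w+\overline w)\nu(w)$, $x\in\mathbb F_q^*$. The cuspidal representation $\rho_\nu$ acts on $L(\mathbb F_q^* )=\{f:\mathbb F_q^*\to\mathbb C\}$ (with $\langle f_1,f_2\rangle=\sum f_1\overline{f_2}$) by $[\rho_\nu(g)f](y)=\nu(\delta)\chi(\delta^{-1}\beta y^{-1})f(\delta\alpha^{-1}y)$ if $g=\begin{pmatrix} \alpha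 & \beta \\ 0 & \delta \end{pmatrix}$, and $[\rho_\nu(g)f](y)=-\sum_{x\in\mathbb F_q^*}\nu(-\gamma x)\chi(\alpha\gamma^{-1}y^{-1}+\gamma^{-1}\delta x^{-1})j(\gamma^{-2}y^{-1}x^{-1}\det g)f(x)$ if $g=\begin{pmatrix} \alpha & \beta \\ \gamma & \delta \end{pmatrix}$ with $\gamma\neq0$. Under the stated conditions $\rho_\nu$ is contained with multiplicity one in $\mathrm{Ind}_C^G\nu_0$. The associated spherical function is $\phi^\nu(g)=\langle f_0,\rho_\nu(g)f_0\rangle$, where $f_0\in L(\mathbb F_q^* )$ is the unit vector, unique up to a unimodular scalar, with $\rho_\nu(c)f_0=\nu_0(c)f_0$ for all $c\in C$. *)

theory Defs
  imports "HOL-Analysis.Analysis"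
begin

(* Characters of the abelian group with carrier S and operation f, as functions on the
   ambient type that are extended by 0 outside S, so that two characters are equal as group
   characters iff they are equal as functions. *)
definition characters :: "'g set \<Rightarrow> ('g \<Rightarrow> 'g \<Rightarrow> 'g) \<Rightarrow> ('g \<Rightarrow> complex) set" where
  "characters S f = {\<psi>. (\<forall>x\<in>S. norm (\<psi> x) = 1)
                        \<and> (\<forall>x\<in>S. \<forall>y\<in>S. \<psi> (f x y) = \<psi> x * \<psi> y)
                        \<and> (\<forall>x. x \<notin> S \<longrightarrow> \<psi> x = 0)}"

definition additive_characters :: "('a::ab_group_add \<Rightarrow> complex) set" where
  "additive_characters = characters UNIV (+)"

definition mult_characters :: "('a::field \<Rightarrow> complex) set" where
  "mult_characters = characters (UNIV - {0}) (*)"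

definition is_generator :: "'a::field \<Rightarrow> bool" where
  "is_generator \<eta> \<longleftrightarrow> \<eta> \<noteq> 0 \<and> (\<forall>x. x \<noteq> 0 \<longrightarrow> (\<exists>n::nat. x = \<eta> ^ n))"


section \<open>The quadratic extension\<close>

(* The pair (a, b) stands for a + i b with i^2 = \<eta>; addition is the componentwise addition
   of the product type.  For \<eta> a non-square this is a field with q^2 elements. *)

definition ext_mult :: "'a::field \<Rightarrow> 'a \<times> 'a \<Rightarrow> 'a \<times> 'a \<Rightarrow> 'a \<times> 'a" where
  "ext_mult \<eta> w z = (fst w * fst z + \<eta> * (snd w * snd z), fst w * snd z + snd w * fst z)"

definition ext_of :: "'a::field \<Rightarrow> 'a \<times> 'a" where
  "ext_of x = (x, 0)"

definition ext_conj :: "'a::field \<times> 'a \<Rightarrow> 'a \<times> 'a" where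
  "ext_conj w = (fst w, - snd w)"

(* w + conj w and w * conj w lie in the base field (lemmas ext_of_trace and ext_of_norm);
   these are the corresponding elements of the base field. *)
definition ext_trace :: "'a::field \<times> 'a \<Rightarrow> 'a" where
  "ext_trace w = fst (w + ext_conj w)"

definition ext_norm :: "'a::field \<Rightarrow> 'a \<times> 'a \<Rightarrow> 'a" where
  "ext_norm \<eta> w = fst (ext_mult \<eta> w (ext_conj w))"

lemma ext_of_trace: "ext_of (ext_trace w) = w + ext_conj w"
  by (simp add: ext_of_def ext_trace_def ext_conj_def prod_eq_iff)

lemma ext_of_norm: "ext_of (ext_norm \<eta> w) = ext_mult \<eta> w (ext_conj w)"
  by (simp add: ext_of_def ext_norm_def ext_mult_def ext_conj_def prod_eq_iff)

lemma ext_mult_commute: "ext_mult \<eta> w z = ext_mult \<eta> z w"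
  by (simp add: ext_mult_def algebra_simps)

lemma ext_mult_assoc: "ext_mult \<eta> (ext_mult \<eta> u w) z = ext_mult \<eta> u (ext_mult \<eta> w z)"
  by (simp add: ext_mult_def algebra_simps)

lemma ext_mult_inverse:
  assumes "\<nexists>s. \<eta> = s ^ 2" and "w \<noteq> 0"
  shows "\<exists>z. ext_mult \<eta> w z = ext_of 1"
proof -
  obtain a b where w: "w = (a, b)" by (cases w)
  define n where "n = a * a - \<eta> * (b * b)"
  have "n \<noteq> 0"
  proof
    assume n0: "n = 0"
    show False
    proof (cases "b = 0")
      case True
      then show False using n0 w assms(2) by (simp add: n_def zero_prod_def)
    next
      case False
      then have "\<eta> = (a / b) ^ 2"
        using n0 by (simp add: n_def power2_eq_square field_simps)
      then show False using assms(1) by blast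
    qed
  qed
  moreover have "a * (a / n) + \<eta> * (b * (- b / n)) = (a * a - \<eta> * (b * b)) / n"
    by (simp add: diff_divide_distrib)
  ultimately have "ext_mult \<eta> w (a / n, - b / n) = ext_of 1"
    by (simp add: w ext_mult_def ext_of_def n_def [symmetric])
  then show ?thesis by blast
qed

definition ext_characters :: "'a::field \<Rightarrow> ('a \<times> 'a \<Rightarrow> complex) set" where
  "ext_characters \<eta> = characters (UNIV - {0}) (ext_mult \<eta>)"

definition sharp :: "('a::field \<times> 'a \<Rightarrow> complex) \<Rightarrow> 'a \<Rightarrow> complex" where
  "sharp \<nu> = (\<lambda>x. \<nu> (ext_of x))"

definition conj_character :: "('a::field \<times> 'a \<Rightarrow> complex) \<Rightarrow> 'a \<times> 'a \<Rightarrow> complex" where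
  "conj_character \<nu> = (\<lambda>w. \<nu> (ext_conj w))"

definition decomposable :: "'a::field \<Rightarrow> ('a \<times> 'a \<Rightarrow> complex) \<Rightarrow> bool" where
  "decomposable \<eta> \<nu> \<longleftrightarrow>
     (\<exists>\<psi>\<in>mult_characters. \<forall>w. w \<noteq> 0 \<longrightarrow> \<nu> w = \<psi> (ext_norm \<eta> w))"


section \<open>Matrices\<close>

definition mat2 :: "'a::field \<Rightarrow> 'a \<Rightarrow> 'a \<Rightarrow> 'a \<Rightarrow> 'a ^ 2 ^ 2" where
  "mat2 \<alpha> \<beta> \<gamma> \<delta> = vector [vector [\<alpha>, \<beta>], vector [\<gamma>, \<delta>]]"

definition GL2 :: "('a::field ^ 2 ^ 2) set" where
  "GL2 = {g. invertible g}"

(* The element of the Cartan subgroup that corresponds to w. *)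
definition cartan_mat :: "'a::field \<Rightarrow> 'a \<times> 'a \<Rightarrow> 'a ^ 2 ^ 2" where
  "cartan_mat \<eta> w = mat2 (fst w) (\<eta> * snd w) (snd w) (fst w)"

lemma cartan_mat_mult:
  "cartan_mat \<eta> w ** cartan_mat \<eta> z = cartan_mat \<eta> (ext_mult \<eta> w z)"
  by (simp add: cartan_mat_def mat2_def ext_mult_def matrix_matrix_mult_def vec_eq_iff
        forall_2 sum_2 algebra_simps)


section \<open>The cuspidal representation and its spherical function\<close>

definition bessel_j ::
  "'a::{field,finite} \<Rightarrow> ('a \<Rightarrow> complex) \<Rightarrow> ('a \<times> 'a \<Rightarrow> complex) \<Rightarrow> 'a \<Rightarrow> complex" where
  "bessel_j \<eta> chi \<nu> x =
     (1 / of_nat CARD('a)) *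
     (\<Sum>w\<in>{w. w \<noteq> 0 \<and> ext_norm \<eta> w = x}. chi (ext_trace w) * \<nu> w)"

(* Functions on the nonzero elements are extended by 0 at 0. *)
definition L_star :: "('a::field \<Rightarrow> complex) set" where
  "L_star = {f. f 0 = 0}"

definition L_inner :: "('a::{field,finite} \<Rightarrow> complex) \<Rightarrow> ('a \<Rightarrow> complex) \<Rightarrow> complex" where
  "L_inner f1 f2 = (\<Sum>y\<in>UNIV - {0}. f1 y * cnj (f2 y))"

definition cuspidal_rep ::
  "'a::{field,finite} \<Rightarrow> ('a \<Rightarrow> complex) \<Rightarrow> ('a \<times> 'a \<Rightarrow> complex) \<Rightarrow> 'a ^ 2 ^ 2
     \<Rightarrow> ('a \<Rightarrow> complex) \<Rightarrow> 'a \<Rightarrow> complex" where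
  "cuspidal_rep \<eta> chi \<nu> g f y =
     (let \<alpha> = g $ 1 $ 1; \<beta> = g $ 1 $ 2; \<gamma> = g $ 2 $ 1; \<delta> = g $ 2 $ 2 in
      if y = 0 then 0
      else if \<gamma> = 0 then
        \<nu> (ext_of \<delta>) * chi (inverse \<delta> * \<beta> * inverse y) * f (\<delta> * inverse \<alpha> * y)
      else
        - (\<Sum>x\<in>UNIV - {0}.
             \<nu> (ext_of (- \<gamma> * x))
             * chi (\<alpha> * inverse \<gamma> * inverse y + inverse \<gamma> * \<delta> * inverse x)
             * bessel_j \<eta> chi \<nu> (inverse (\<gamma>\<^sup>2) * inverse y * inverse x * det g)
             * f x))"

definition spherical_vector ::
  "'a::{field,finite} \<Rightarrow> ('a \<Rightarrow> complex) \<Rightarrow> ('a \<times> 'a \<Rightarrow> complex) \<Rightarrow> ('a \<times> 'a \<Rightarrow> complex)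
     \<Rightarrow> ('a \<Rightarrow> complex) \<Rightarrow> bool" where
  "spherical_vector \<eta> chi \<nu>\<^sub>0 \<nu> f\<^sub>0 \<longleftrightarrow>
     f\<^sub>0 \<in> L_star \<and> L_inner f\<^sub>0 f\<^sub>0 = 1 \<and>
     (\<forall>w. w \<noteq> 0 \<longrightarrow> cuspidal_rep \<eta> chi \<nu> (cartan_mat \<eta> w) f\<^sub>0 = (\<lambda>y. \<nu>\<^sub>0 w * f\<^sub>0 y))"

(* The description is meaningful because a spherical vector exists and is unique up to a
   unimodular scalar, on which the matrix coefficient does not depend.  As a function on GL2
   the spherical function is extended by 0 to the singular matrices. *)
definition spherical_function ::
  "'a::{field,finite} \<Rightarrow> ('a \<Rightarrow> complex) \<Rightarrow> ('a \<times> 'a \<Rightarrow> complex) \<Rightarrow> ('a \<times> 'a \<Rightarrow> complex)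
     \<Rightarrow> 'a ^ 2 ^ 2 \<Rightarrow> complex" where
  "spherical_function \<eta> chi \<nu>\<^sub>0 \<nu> =
     (THE \<phi>. \<exists>f\<^sub>0. spherical_vector \<eta> chi \<nu>\<^sub>0 \<nu> f\<^sub>0 \<and>
        \<phi> = (\<lambda>g. if g \<in> GL2 then L_inner f\<^sub>0 (cuspidal_rep \<eta> chi \<nu> g f\<^sub>0) else 0))"

end

theory Submission
  imports Defs
begin

text \<open>
  Write \<open>K\<^sub>w\<close> for the kernel of \<open>\<rho>\<^sub>\<nu>(w)\<close>, where \<open>w\<close> runs over the Cartan subgroup, and let
  \<open>P\<close> be the average of the \<open>K\<^sub>w\<close> against the conjugate of \<open>\<nu>\<^sub>0\<close>. Two quadratic
  identities for the Bessel function \<open>j\<close> (an orthogonality relation and a convolution formula), both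
  reducing to a Gauss sum over the quadratic extension, say that \<open>w \<mapsto> K\<^sub>w\<close> is
  multiplicative. Hence \<open>P\<close> is a Hermitian idempotent, and the trace of \<open>K\<^sub>w\<close>, which is
  \<open>-(\<nu>(w) + \<nu>(ext_conj w))\<close> off the centre, together with the orthogonality of characters shows
  that \<open>P\<close> has trace 1. So \<open>P\<close> is the projection onto the line of a unit vector \<open>f\<^sub>0\<close>, that is,
  \<open>P u v = f\<^sub>0 u * cnj (f\<^sub>0 v)\<close>, and the spherical function is
  the sum of \<open>chi (- y / u) * P u (u / x)\<close>, in which the explicit form of \<open>P\<close> is inserted.
\<close>

section \<open>The quadratic extension and its Gauss sums\<close>

locale quadratic_extension =
  fixes \<eta> :: "'a::{field,finite}" and chi :: "'a \<Rightarrow> complex" and q :: nat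
  assumes q_eq: "q = CARD('a)" and odd_card: "odd q"
    and generator: "is_generator \<eta>"
    and chi: "chi \<in> additive_characters"
    and chi_nontrivial: "\<exists>t. chi t \<noteq> 1"
begin

abbreviation N where "N \<equiv> ext_norm \<eta>"
abbreviation mul (infixl "\<odot>" 70) where "w \<odot> z \<equiv> ext_mult \<eta> w z"
abbreviation fibre :: "'a \<Rightarrow> ('a \<times> 'a) set" where "fibre x \<equiv> {w. w \<noteq> 0 \<and> N w = x}"

lemma ext_norm_eq: "N w = (fst w)\<^sup>2 - \<eta> * (snd w)\<^sup>2"
  by (simp add: ext_norm_def ext_mult_def ext_conj_def power2_eq_square)

lemma trace_eq: "ext_trace w = 2 * fst w"
  by (simp add: ext_trace_def ext_conj_def)

lemma q_nonzero [simp]: "of_nat q \<noteq> (0::complex)"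
  by (simp add: q_eq)

section \<open>Additive characters of the base field and their orthogonality\<close>

lemma chi_add: "chi (x + y) = chi x * chi y"
  and norm_chi: "cmod (chi x) = 1"
  using chi by (auto simp: additive_characters_def characters_def)

lemma chi_nonzero [simp]: "chi x \<noteq> 0"
  using norm_chi[of x] by auto

lemma chi_0 [simp]: "chi 0 = 1"
  using chi_add[of 0 0] by simp

lemma chi_minus: "chi (- x) = cnj (chi x)"
proof -
  have "chi (- x) * chi x = 1"
    using chi_add[of "- x" x] by simp
  moreover have "cnj (chi x) * chi x = 1"
    using norm_chi[of x] by (metis complex_norm_square mult.commute of_real_1 one_power2)
  ultimately show ?thesis
    by (metis chi_nonzero mult_right_cancel)
qed

text \<open>Translating by some \<open>t\<close> with \<open>chi t\<close> different from 1 permutes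
  the field but multiplies the sum by \<open>chi t\<close>.\<close>

lemma sum_chi: "(\<Sum>x\<in>UNIV. chi x) = 0"
proof -
  obtain t where t: "chi t \<noteq> 1" using chi_nontrivial by blast
  have "(\<Sum>x\<in>UNIV. chi x) = (\<Sum>x\<in>UNIV. chi (t + x))"
    by (rule sum.reindex_bij_witness[of _ "\<lambda>x. t + x" "\<lambda>x. x - t"]) auto
  also have "\<dots> = chi t * (\<Sum>x\<in>UNIV. chi x)"
    by (simp add: chi_add sum_distrib_left)
  finally show ?thesis using t by (simp add: algebra_simps)
qed

lemma sum_chi_mult: "(\<Sum>x\<in>UNIV. chi (t * x)) = of_nat q * of_bool (t = 0)"
proof (cases "t = 0")
  case False
  have "(\<Sum>x\<in>UNIV. chi (t * x)) = (\<Sum>x\<in>UNIV. chi x)"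
    by (rule sum.reindex_bij_witness[of _ "\<lambda>x. x / t" "\<lambda>x. t * x"]) (use False in auto)
  then show ?thesis using False sum_chi by simp
qed (simp add: q_eq)

text \<open>Inversion permutes the nonzero elements; the \<open>- 1\<close> is the term at 0 that
  completes the sum. This evaluates both the trace of the kernels and the delta term of the final
  formula.\<close>

lemma sum_chi_divide: "(\<Sum>x\<in>UNIV - {0}. chi (t / x)) = of_nat q * of_bool (t = 0) - 1"
proof -
  have "(\<Sum>x\<in>UNIV - {0}. chi (t / x)) = (\<Sum>x\<in>UNIV - {0}. chi (t * x))"
    by (rule sum.reindex_bij_witness[of _ inverse inverse]) (auto simp: field_simps)
  also have "\<dots> = (\<Sum>x\<in>UNIV. chi (t * x)) - 1"
    by (simp add: sum_diff1)
  finally show ?thesis by (simp add: sum_chi_mult)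
qed

text \<open>In characteristic 2 the character takes only the values \<open>1\<close> and \<open>- 1\<close>, and the vanishing of
  its sum forces them to occur equally often.\<close>

lemma two_neq_0: "(2::'a) \<noteq> 0"
proof
  assume two: "(2::'a) = 0"
  have val: "chi x = 1 \<or> chi x = - 1" for x
  proof -
    have "x + x = 0" using two by (metis mult_2 mult_zero_left)
    then have "chi x * chi x = 1" by (metis chi_add chi_0)
    then show ?thesis by (simp add: square_eq_1_iff)
  qed
  define A B where "A = {x. chi x = 1}" and "B = {x. chi x \<noteq> 1}"
  have AB: "UNIV = A \<union> B" "A \<inter> B = {}" by (auto simp: A_def B_def)
  have "0 = (\<Sum>x\<in>A. chi x) + (\<Sum>x\<in>B. chi x)"
    using sum_chi AB sum.union_disjoint[of A B chi] by simp
  also have "(\<Sum>x\<in>A. chi x) = of_nat (card A)" by (simp add: A_def)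
  also have "(\<Sum>x\<in>B. chi x) = (\<Sum>x\<in>B. - 1)"
    using val by (intro sum.cong) (auto simp: B_def)
  finally have "card A = card B" by simp
  moreover have "CARD('a) = card A + card B"
    using AB card_Un_disjoint[of A B] by simp
  ultimately show False using odd_card q_eq by simp
qed

lemma eta_neq_0: "\<eta> \<noteq> 0"
  using generator by (simp add: is_generator_def)

text \<open>If \<open>\<eta>\<close> were a square, squaring would be surjective, hence injective; but \<open>1\<close> and \<open>- 1\<close> have
  the same square.\<close>

lemma eta_nonsquare: "\<eta> \<noteq> s\<^sup>2"
proof
  assume s: "\<eta> = s\<^sup>2"
  have "\<exists>y. x = y\<^sup>2" for x :: 'a
  proof (cases "x = 0")
    case False
    then obtain n where "x = \<eta> ^ n" using generator by (auto simp: is_generator_def)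
    then have "x = (s ^ n)\<^sup>2" using s by (simp add: power_mult[symmetric] mult.commute)
    then show ?thesis by blast
  qed (auto intro: exI[of _ 0])
  then have "surj (\<lambda>x::'a. x\<^sup>2)" by (auto simp: surj_def)
  then have "inj (\<lambda>x::'a. x\<^sup>2)" by (simp add: finite_UNIV_surj_inj)
  then have "(1::'a) = - 1" by (rule injD) simp
  then have "(1::'a) + 1 = 0" by (metis add.right_inverse)
  then show False using two_neq_0 by simp
qed

section \<open>The norm and inverses in the quadratic extension\<close>

lemma ext_norm_mult: "N (w \<odot> z) = N w * N z"
  by (simp add: ext_norm_eq ext_mult_def algebra_simps power2_eq_square)

lemma ext_norm_0 [simp]: "N 0 = 0"
  by (simp add: ext_norm_eq)

lemma ext_norm_eq_0_iff [simp]: "N w = 0 \<longleftrightarrow> w = 0"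
proof
  assume *: "N w = 0"
  show "w = 0"
  proof (cases "snd w = 0")
    case True
    then show ?thesis using * by (simp add: ext_norm_eq prod_eq_iff)
  next
    case False
    then have "\<eta> = (fst w / snd w)\<^sup>2"
      using * by (simp add: ext_norm_eq field_simps power2_eq_square)
    then show ?thesis using eta_nonsquare by blast
  qed
qed simp

lemma ext_norm_conj [simp]: "N (ext_conj w) = N w"
  by (simp add: ext_norm_eq ext_conj_def)

lemma ext_norm_of [simp]: "N (ext_of x) = x\<^sup>2"
  by (simp add: ext_norm_eq ext_of_def)

lemma ext_norm_Pair: "N (x, y) = x\<^sup>2 - \<eta> * y\<^sup>2"
  by (simp add: ext_norm_eq)

lemma mul_eq_0_iff [simp]: "w \<odot> z = 0 \<longleftrightarrow> w = 0 \<or> z = 0"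
  by (metis ext_norm_eq_0_iff ext_norm_mult mult_eq_0_iff)

lemma ext_of_eq_0_iff [simp]: "ext_of x = 0 \<longleftrightarrow> x = 0"
  by (auto simp: ext_of_def zero_prod_def)

lemma mul_0 [simp]: "0 \<odot> w = 0" "w \<odot> 0 = 0"
  by simp_all

lemma ext_of_0 [simp]: "ext_of 0 = 0"
  by simp

lemma mul_conj: "w \<odot> ext_conj w = ext_of (N w)"
  by (rule ext_of_norm[symmetric])

lemma mul_1 [simp]: "ext_of 1 \<odot> w = w" "w \<odot> ext_of 1 = w"
  by (simp_all add: ext_of_def ext_mult_def)

lemma mul_of_of: "ext_of x \<odot> ext_of y = ext_of (x * y)"
  by (simp add: ext_of_def ext_mult_def)

text \<open>The field inverse, conjugate over norm, written out because pairs carry only the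
  explicit product \<open>ext_mult\<close>.\<close>

definition einv :: "'a \<times> 'a \<Rightarrow> 'a \<times> 'a" where
  "einv w = ext_conj w \<odot> ext_of (inverse (N w))"

lemma mul_einv: "w \<noteq> 0 \<Longrightarrow> w \<odot> einv w = ext_of 1"
  by (simp add: einv_def ext_mult_assoc[symmetric] mul_conj mul_of_of)

lemma einv_mul: "w \<noteq> 0 \<Longrightarrow> einv w \<odot> w = ext_of 1"
  using mul_einv ext_mult_commute by metis

lemma mul_einv_cancel [simp]:
  assumes "w \<noteq> 0"
  shows "z \<odot> w \<odot> einv w = z" "z \<odot> einv w \<odot> w = z"
    "w \<odot> (einv w \<odot> z) = z" "einv w \<odot> (w \<odot> z) = z"
  using assms by (simp_all add: ext_mult_assoc mul_einv einv_mul) (simp_all add: ext_mult_assoc[symmetric] mul_einv einv_mul)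

lemma einv_nonzero [simp]: "w \<noteq> 0 \<Longrightarrow> einv w \<noteq> 0"
  by (metis einv_mul ext_of_eq_0_iff mul_eq_0_iff zero_neq_one)

lemma ext_norm_einv: "w \<noteq> 0 \<Longrightarrow> N (einv w) = inverse (N w)"
  by (simp add: einv_def ext_norm_mult power2_eq_square)

lemma conj_simps [simp]: "ext_conj (ext_conj w) = w" "ext_conj w = 0 \<longleftrightarrow> w = 0" "ext_conj 0 = 0"
  by (auto simp: ext_conj_def prod_eq_iff)

section \<open>Fibres of the norm and their size\<close>

text \<open>Multiplication by \<open>w\<close> is a bijection between the two fibres, with inverse
  multiplication by \<open>einv w\<close>. All rescalings of Bessel sums go through this
  rule.\<close>

lemma sum_fibre_mult:
  assumes "w \<noteq> 0"
  shows "(\<Sum>z\<in>fibre (x * N w). f z) = (\<Sum>s\<in>fibre x. f (s \<odot> w))"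
  by (rule sum.reindex_bij_witness[of _ "\<lambda>s. s \<odot> w" "\<lambda>z. z \<odot> einv w"])
     (use assms in \<open>auto simp: ext_norm_mult ext_norm_einv\<close>)

lemma sum_norm_fibres:
  "(\<Sum>w\<in>UNIV - {0}. f w) = (\<Sum>x\<in>UNIV - {0}. \<Sum>w\<in>fibre x. f w)"
proof -
  have "(\<Sum>x\<in>UNIV - {0}. \<Sum>w\<in>fibre x. f w)
      = (\<Sum>x\<in>UNIV - {0}. \<Sum>w\<in>{w \<in> UNIV - {0}. N w = x}. f w)"
    by (intro sum.cong) auto
  also have "\<dots> = (\<Sum>w\<in>UNIV - {0}. f w)"
    by (rule sum.group) auto
  finally show ?thesis ..
qed

text \<open>A nonzero square has at most two roots and 0 has only one, so \<open>q\<close> is at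
  most twice the number of nonzero squares plus 1.\<close>

lemma double_squares_card:
  "q < 2 * card (range (\<lambda>a::'a. a\<^sup>2))"
proof -
  define S where "S = range (\<lambda>a::'a. a\<^sup>2)"
  have "q = card (\<Union>x\<in>S. {a. a\<^sup>2 = x})"
    unfolding q_eq by (rule arg_cong[of _ _ card]) (auto simp: S_def)
  also have "(\<Union>x\<in>S. {a. a\<^sup>2 = x}) = (\<Union>x\<in>S - {0}. {a. a\<^sup>2 = x}) \<union> {0}"
    by (auto simp: S_def)
  also have "card \<dots> \<le> card (\<Union>x\<in>S - {0}. {a. a\<^sup>2 = x}) + 1"
    using card_Un_le[of _ "{0}"] by simp
  also have "card (\<Union>x\<in>S - {0}. {a. a\<^sup>2 = x}) \<le> (\<Sum>x\<in>S - {0}. card {a. a\<^sup>2 = x})"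
    by (rule card_UN_le) simp
  also have "\<dots> \<le> (\<Sum>x\<in>S - {0}. 2)"
  proof (rule sum_mono)
    fix x assume "x \<in> S - {0}"
    then obtain a where "x = a\<^sup>2" by (auto simp: S_def)
    then have "{b. b\<^sup>2 = x} \<subseteq> {a, - a}" by (auto simp: power2_eq_iff)
    then have "card {b. b\<^sup>2 = x} \<le> card {a, - a}" by (intro card_mono) auto
    then show "card {b. b\<^sup>2 = x} \<le> 2" by (auto simp: card_insert_if split: if_splits)
  qed
  also have "\<dots> = 2 * (card S - 1)"
    by (subst sum_constant, subst card_Diff_singleton) (auto simp: S_def intro: range_eqI[of _ _ 0])
  finally have "q \<le> 2 * (card S - 1) + 1" by simp
  moreover have "card S > 0" by (simp add: S_def card_gt_0_iff)
  ultimately show ?thesis by (simp add: S_def)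
qed

text \<open>Pigeonhole: the sets of all \<open>a\<^sup>2\<close> and of all
  \<open>u + \<eta> * b\<^sup>2\<close> each fill more than half of the field, hence they
  meet.\<close>

lemma ext_norm_surj: "\<exists>w. N w = u"
proof -
  define A B where "A = range (\<lambda>a::'a. a\<^sup>2)" and "B = (\<lambda>x. u + \<eta> * x) ` A"
  have cB: "card B = card A"
    unfolding B_def by (intro card_image inj_onI) (simp add: eta_neq_0)
  have "A \<inter> B \<noteq> {}"
  proof
    assume "A \<inter> B = {}"
    then have "card A + card B = card (A \<union> B)" by (subst card_Un_disjoint) auto
    also have "\<dots> \<le> q" unfolding q_eq by (rule card_mono) auto
    finally show False using double_squares_card cB by (simp add: A_def)
  qed
  then obtain a b where "a\<^sup>2 = u + \<eta> * b\<^sup>2" by (auto simp: A_def B_def)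
  then have "N (a, b) = u" by (simp add: ext_norm_Pair)
  then show ?thesis by blast
qed

text \<open>An element of norm \<open>v\<close> carries the fibre over 1 onto the fibre over
  \<open>v\<close>, so the \<open>q - 1\<close> fibres over nonzero elements have equal size;
  together they exhaust the \<open>q * q - 1\<close> nonzero elements.\<close>

lemma card_fibre:
  assumes "u \<noteq> 0"
  shows "card (fibre u) = q + 1"
proof -
  have eq: "card (fibre v) = card (fibre 1)" if "v \<noteq> 0" for v
  proof -
    obtain w where w: "N w = v" using ext_norm_surj by blast
    then show ?thesis
      using sum_fibre_mult[of w "\<lambda>_. 1::nat" 1] that by auto
  qed
  have "q * q - 1 = (\<Sum>w\<in>UNIV - {0::'a \<times> 'a}. 1)"
    by (simp add: card_Diff_singleton q_eq)
  also have "\<dots> = (\<Sum>x\<in>UNIV - {0}. card (fibre x))"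
    by (subst sum_norm_fibres) simp
  also have "\<dots> = (\<Sum>x\<in>UNIV - {0::'a}. card (fibre 1))"
    by (rule sum.cong) (use eq in blast)+
  also have "\<dots> = (q - 1) * card (fibre 1)"
    by (simp add: card_Diff_singleton q_eq)
  finally have "(q - 1) * card (fibre 1) = q * q - 1" ..
  also have "\<dots> = (q - 1) * (q + 1)"
    by (cases q) simp_all
  finally have "(q - 1) * card (fibre 1) = (q - 1) * (q + 1)" .
  moreover have "card {0, 1::'a} \<le> q" unfolding q_eq by (rule card_mono) auto
  then have "q - 1 \<noteq> 0" by simp
  ultimately have "card (fibre 1) = q + 1" by (metis mult_left_cancel)
  then show ?thesis unfolding eq[OF assms] .
qed

section \<open>Exponential sums of the trace and the norm\<close>

text \<open>Non-degeneracy of the trace form: in coordinates the sum splits into two sums over the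
  base field, with coefficients \<open>2 * fst c\<close> and \<open>2 * \<eta> * snd c\<close>, and
  neither 2 nor \<eta> vanishes.\<close>

lemma sum_chi_trace: "(\<Sum>w\<in>UNIV. chi (ext_trace (w \<odot> c))) = (of_nat q)\<^sup>2 * of_bool (c = 0)"
proof -
  have "(\<Sum>w\<in>UNIV. chi (ext_trace (w \<odot> c)))
      = (\<Sum>(a, b)\<in>UNIV \<times> UNIV. chi (2 * fst c * a) * chi (2 * \<eta> * snd c * b))"
    by (intro sum.cong) (auto simp: trace_eq ext_mult_def chi_add[symmetric] algebra_simps)
  also have "\<dots> = (\<Sum>a\<in>UNIV. chi (2 * fst c * a)) * (\<Sum>b\<in>UNIV. chi (2 * \<eta> * snd c * b))"
    by (simp only: sum.cartesian_product[symmetric] sum_product)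
  also have "\<dots> = (of_nat q)\<^sup>2 * of_bool (c = 0)"
    by (simp add: sum_chi_mult two_neq_0 eta_neq_0 prod_eq_iff power2_eq_square)
  finally show ?thesis .
qed

text \<open>Grouping by the norm, 0 contributes 1 and every nonzero value occurs
  \<open>q + 1\<close> times, which gives 1 - (q + 1) = -q.\<close>

lemma sum_chi_norm:
  assumes "t \<noteq> 0"
  shows "(\<Sum>w\<in>UNIV. chi (t * N w)) = - of_nat q"
proof -
  have "(\<Sum>w\<in>UNIV. chi (t * N w)) = 1 + (\<Sum>w\<in>UNIV - {0}. chi (t * N w))"
    by (subst sum.remove[of _ 0]) auto
  also have "(\<Sum>w\<in>UNIV - {0}. chi (t * N w)) = (\<Sum>x\<in>UNIV - {0}. (of_nat q + 1) * chi (t * x))"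
    unfolding sum_norm_fibres by (rule sum.cong) (simp_all add: card_fibre add.commute)
  also have "\<dots> = (of_nat q + 1) * ((\<Sum>x\<in>UNIV. chi (t * x)) - 1)"
    by (simp add: sum_distrib_left[symmetric] sum_diff1)
  finally show ?thesis using assms by (simp add: sum_chi_mult)
qed

text \<open>Completing the square: a translation of \<open>w\<close> removes the linear term and
  leaves the pure norm sum.\<close>

lemma gauss_sum:
  assumes "c \<noteq> 0"
  shows "(\<Sum>w\<in>UNIV. chi (c * N w + ext_trace (w \<odot> d))) = - of_nat q * chi (- N d / c)"
proof -
  \<comment> \<open>This is the conjugate of \<open>d\<close> divided by \<open>c\<close>, so that
    the mixed term of \<open>c * N (w + e)\<close> is exactly the trace of
    \<open>w \<odot> d\<close>.\<close>
  define e where "e = (fst d / c, - snd d / c)"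
  have square: "c * (x + y / c)\<^sup>2 = c * x\<^sup>2 + 2 * x * y + y\<^sup>2 / c" for x y
  proof -
    have "c * (x + z)\<^sup>2 = c * x\<^sup>2 + 2 * x * (c * z) + (c * z) * z" for z
      by (simp add: power2_eq_square algebra_simps)
    from this[of "y / c"] show ?thesis using assms by (simp add: power2_eq_square)
  qed
  have sq: "c * N w + ext_trace (w \<odot> d) = c * N (w + e) + - N d / c" for w
  proof -
    have N: "c * N (w + e) = c * (fst w + fst d / c)\<^sup>2 - \<eta> * (c * (snd w + - snd d / c)\<^sup>2)"
      unfolding ext_norm_eq e_def fst_add snd_add fst_conv snd_conv right_diff_distrib
      by (simp only: mult.left_commute)
    have "c * N (w + e) = c * N w + ext_trace (w \<odot> d) + N d / c"
      unfolding N square by (simp add: ext_norm_eq trace_eq ext_mult_def algebra_simps diff_divide_distrib)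
    then show ?thesis by simp
  qed
  have "(\<Sum>w\<in>UNIV. chi (c * N w + ext_trace (w \<odot> d)))
      = (\<Sum>w\<in>UNIV. chi (c * N (w + e))) * chi (- N d / c)"
    by (simp only: sq chi_add sum_distrib_right)
  also have "(\<Sum>w\<in>UNIV. chi (c * N (w + e))) = (\<Sum>w\<in>UNIV. chi (c * N w))"
    by (rule sum.reindex_bij_witness[of _ "\<lambda>w. w - e" "\<lambda>w. w + e"]) auto
  finally show ?thesis using assms by (simp add: sum_chi_norm)
qed

section \<open>Decomposition of the extension along the base field\<close>

text \<open>A nonzero element either lies in the base field or is uniquely b(\<gamma> + i) with b
  nonzero; the second kind produces the sum over \<gamma> in the final formula.\<close>

lemma sum_polar:
  "(\<Sum>w\<in>UNIV - {0}. f w)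
    = (\<Sum>a\<in>UNIV - {0}. f (ext_of a)) + (\<Sum>b\<in>UNIV - {0}. \<Sum>\<gamma>\<in>UNIV. f (ext_of b \<odot> (\<gamma>, 1)))"
proof -
  have "(\<Sum>w\<in>UNIV - {0}. f w)
      = (\<Sum>w\<in>ext_of ` (UNIV - {0}). f w) + (\<Sum>w\<in>{w. snd w \<noteq> 0}. f w)"
    by (subst sum.union_disjoint[symmetric])
      (auto simp: ext_of_def prod_eq_iff image_iff intro!: sum.cong)
  also have "(\<Sum>w\<in>ext_of ` (UNIV - {0}). f w) = (\<Sum>a\<in>UNIV - {0}. f (ext_of a))"
    by (subst sum.reindex) (auto simp: inj_on_def ext_of_def)
  also have "(\<Sum>w\<in>{w. snd w \<noteq> 0}. f w)
      = (\<Sum>(b, \<gamma>)\<in>(UNIV - {0}) \<times> UNIV. f (ext_of b \<odot> (\<gamma>, 1)))"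
    by (rule sum.reindex_bij_witness[of _ "\<lambda>(b, \<gamma>). ext_of b \<odot> (\<gamma>, 1)" "\<lambda>w. (snd w, fst w / snd w)"])
      (auto simp: ext_of_def ext_mult_def)
  also have "\<dots> = (\<Sum>b\<in>UNIV - {0}. \<Sum>\<gamma>\<in>UNIV. f (ext_of b \<odot> (\<gamma>, 1)))"
    by (rule sum.cartesian_product[symmetric])
  finally show ?thesis .
qed

lemma q_pos: "q - 1 > 0"
proof -
  have "card {0, 1::'a} \<le> q" unfolding q_eq by (rule card_mono) auto
  then show ?thesis by simp
qed

text \<open>The elements 1 and \<gamma> + i represent the \<open>q + 1\<close> classes modulo
  nonzero scalars, and each class has \<open>q - 1\<close> members.\<close>

lemma sum_polar_invariant:
  fixes f :: "'a \<times> 'a \<Rightarrow> complex"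
  assumes "\<And>b w. b \<noteq> 0 \<Longrightarrow> f (ext_of b \<odot> w) = f w"
  shows "(\<Sum>w\<in>UNIV - {0}. f w) = (of_nat q - 1) * (f (ext_of 1) + (\<Sum>\<gamma>\<in>UNIV. f (\<gamma>, 1)))"
proof -
  have "f (ext_of a) = f (ext_of 1)" if "a \<noteq> 0" for a
    using assms[OF that, of "ext_of 1"] by simp
  then have "(\<Sum>a\<in>UNIV - {0}. f (ext_of a)) = (\<Sum>a\<in>UNIV - {0::'a}. f (ext_of 1))"
    by (intro sum.cong refl) blast
  moreover have "(\<Sum>b\<in>UNIV - {0}. \<Sum>\<gamma>\<in>UNIV. f (ext_of b \<odot> (\<gamma>, 1)))
      = (\<Sum>b\<in>UNIV - {0::'a}. \<Sum>\<gamma>\<in>UNIV. f (\<gamma>, 1))"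
    by (intro sum.cong refl, rule assms) auto
  moreover have "of_nat (card (UNIV - {0::'a})) = (of_nat q - 1 :: complex)"
    using q_pos by (simp add: card_Diff_singleton q_eq of_nat_diff)
  ultimately show ?thesis
    unfolding sum_polar[of f] by (simp add: distrib_left)
qed

lemma sum_mult_shift:
  assumes "z \<noteq> 0"
  shows "(\<Sum>w\<in>UNIV - {0}. f (z \<odot> w)) = (\<Sum>w\<in>UNIV - {0}. f w)"
  by (rule sum.reindex_bij_witness[of _ "\<lambda>w. einv z \<odot> w" "\<lambda>w. z \<odot> w"]) (use assms in auto)

lemma einv_einv: "w \<noteq> 0 \<Longrightarrow> einv (einv w) = w"
  by (metis einv_nonzero mul_1(1) mul_einv mul_einv_cancel(2))

end

section \<open>Bessel functions of characters of the extension\<close>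

locale ext_character = quadratic_extension +
  fixes \<nu> :: "'a \<times> 'a \<Rightarrow> complex"
  assumes nu: "\<nu> \<in> ext_characters \<eta>"
begin

abbreviation j where "j \<equiv> bessel_j \<eta> chi \<nu>"

section \<open>Values of a character of the extension\<close>

lemma nu_0 [simp]: "\<nu> 0 = 0"
  using nu by (simp add: ext_characters_def characters_def)

lemma nu_mult: "\<nu> (w \<odot> z) = \<nu> w * \<nu> z"
proof (cases "w = 0 \<or> z = 0")
  case True
  then show ?thesis by auto
next
  case False
  then show ?thesis using nu by (simp add: ext_characters_def characters_def)
qed

lemma norm_nu: "w \<noteq> 0 \<Longrightarrow> cmod (\<nu> w) = 1"
  using nu by (simp add: ext_characters_def characters_def)

lemma nu_eq_0_iff [simp]: "\<nu> w = 0 \<longleftrightarrow> w = 0"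
  using norm_nu[of w] by (cases "w = 0") auto

lemma cnj_nu: "cnj (\<nu> w) = inverse (\<nu> w)"
proof (cases "w = 0")
  case False
  then have "\<nu> w * cnj (\<nu> w) = 1"
    using norm_nu[of w] by (simp add: complex_norm_square[symmetric])
  then show ?thesis by (metis inverse_unique)
qed simp

lemma nu_1 [simp]: "\<nu> (ext_of 1) = 1"
  using nu_mult[of "ext_of 1" "ext_of 1"] by simp

lemma nu_of_mult: "\<nu> (ext_of (x * y)) = \<nu> (ext_of x) * \<nu> (ext_of y)"
  by (simp add: nu_mult[symmetric] mul_of_of)

lemma nu_of_inverse: "\<nu> (ext_of (inverse x)) = inverse (\<nu> (ext_of x))"
proof (cases "x = 0")
  case True
  then show ?thesis using True by simp
next
  case False
  then have "\<nu> (ext_of x) * \<nu> (ext_of (inverse x)) = 1"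
    by (simp add: nu_of_mult[symmetric])
  then show ?thesis by (metis inverse_unique)
qed

lemma nu_of_divide: "\<nu> (ext_of (x / y)) = \<nu> (ext_of x) / \<nu> (ext_of y)"
  by (simp add: divide_inverse nu_of_mult nu_of_inverse)

lemma nu_of_minus: "\<nu> (ext_of (- x)) = \<nu> (ext_of (- 1)) * \<nu> (ext_of x)"
  by (simp add: nu_of_mult[symmetric])

lemma nu_minus_1_square: "\<nu> (ext_of (- 1)) * \<nu> (ext_of (- 1)) = 1"
  by (simp add: nu_of_mult[symmetric])

lemma nu_uminus: "\<nu> (- w) = \<nu> (ext_of (- 1)) * \<nu> w"
proof -
  have "- w = ext_of (- 1) \<odot> w" by (simp add: ext_of_def ext_mult_def prod_eq_iff)
  then show ?thesis by (simp only: nu_mult)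
qed

lemma nu_conj: "\<nu> (ext_conj w) = \<nu> (ext_of (N w)) / \<nu> w"
proof (cases "w = 0")
  case False
  then show ?thesis by (simp add: mul_conj[symmetric] nu_mult)
qed simp

lemma nu_einv: "w \<noteq> 0 \<Longrightarrow> \<nu> (einv w) = inverse (\<nu> w)"
  by (metis inverse_unique mul_einv nu_1 nu_mult)

text \<open>A character that is trivial on the elements of norm 1 factors through the norm.\<close>

lemma indecomposable_witness:
  assumes "\<not> decomposable \<eta> \<nu>"
  shows "\<exists>s. N s = 1 \<and> \<nu> s \<noteq> 1"
proof (rule ccontr)
  assume "\<nexists>s. N s = 1 \<and> \<nu> s \<noteq> 1"
  then have triv: "\<nu> s = 1" if "N s = 1" for s using that by blast
  have eq: "\<nu> w = \<nu> z" if "N w = N z" "z \<noteq> 0" for w z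
  proof -
    have "w = (w \<odot> einv z) \<odot> z" using that by simp
    moreover have "\<nu> (w \<odot> einv z) = 1"
      using that by (intro triv) (simp add: ext_norm_mult ext_norm_einv)
    ultimately show ?thesis by (metis mult_1 nu_mult)
  qed
  \<comment> \<open>A section of the norm. By \<open>eq\<close>, the value
    \<open>\<nu> (r x)\<close> does not depend on the choice of a preimage of a nonzero
    \<open>x\<close>.\<close>
  define r where "r x = (SOME w. N w = x)" for x
  have r: "N (r x) = x" for x
    unfolding r_def by (rule someI_ex) (rule ext_norm_surj)
  define \<psi> where "\<psi> x = \<nu> (r x)" for x
  have \<psi>: "\<psi> (N w) = \<nu> w" for w
  proof (cases "w = 0")
    case True
    then show ?thesis using r[of 0] by (simp add: \<psi>_def)
  qed (simp add: \<psi>_def r eq[of "r (N w)" w])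
  have "\<psi> \<in> mult_characters"
    unfolding mult_characters_def characters_def
  proof (intro CollectI conjI ballI allI impI)
    fix x y :: 'a
    show "\<psi> (x * y) = \<psi> x * \<psi> y"
      using \<psi>[of "r x \<odot> r y"] by (simp add: ext_norm_mult r nu_mult \<psi>_def)
    show "cmod (\<psi> x) = 1" if "x \<in> UNIV - {0}"
      using norm_nu[of "r x"] ext_norm_eq_0_iff[of "r x"] that
      by (simp add: \<psi>_def r del: ext_norm_eq_0_iff)
    show "\<psi> x = 0" if "x \<notin> UNIV - {0}"
      using r[of 0] that by (simp add: \<psi>_def)
  qed
  then have "decomposable \<eta> \<nu>"
    unfolding decomposable_def using \<psi> by (intro bexI[of _ \<psi>]) auto
  then show False using assms by blast
qed

text \<open>A norm-one element \<open>s\<close> with \<open>\<nu> s\<close> different from 1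
  permutes the fibre and multiplies the sum by \<open>\<nu> s\<close>. This is how indecomposability
  enters the Bessel identities and the trace.\<close>

lemma sum_nu_fibre:
  assumes "\<not> decomposable \<eta> \<nu>"
  shows "(\<Sum>w\<in>fibre x. \<nu> w) = 0"
proof -
  obtain s where s: "N s = 1" "\<nu> s \<noteq> 1" using indecomposable_witness[OF assms] by blast
  then have "s \<noteq> 0" by auto
  then have "(\<Sum>w\<in>fibre x. \<nu> w) = (\<Sum>w\<in>fibre x. \<nu> w) * \<nu> s"
    using sum_fibre_mult[of s \<nu> x] unfolding s(1) sum_distrib_right by (simp add: nu_mult)
  then show ?thesis using s by simp
qed

section \<open>The Bessel function: conjugation, orthogonality and convolution\<close>

lemma bessel_eq: "of_nat q * j x = (\<Sum>w\<in>fibre x. chi (ext_trace w) * \<nu> w)"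
  using q_nonzero by (simp add: bessel_j_def q_eq)

text \<open>The substitution of \<open>- ext_conj w\<close> for \<open>w\<close> keeps the norm,
  negates the trace and turns \<open>\<nu> w\<close> into
  \<open>\<nu> (ext_of (- x)) / \<nu> w\<close>, while conjugation inverts \<open>\<nu> w\<close>.
  At \<open>x = 0\<close> both sides vanish.\<close>

lemma cnj_bessel: "cnj (j x) = \<nu> (ext_of (- inverse x)) * j x"
proof -
  have "(\<Sum>w\<in>fibre x. cnj (chi (ext_trace w)) * cnj (\<nu> w))
      = (\<Sum>w\<in>fibre x. \<nu> (ext_of (- inverse x)) * (chi (ext_trace w) * \<nu> w))"
  proof (rule sum.reindex_bij_witness[of _ "\<lambda>w. - ext_conj w" "\<lambda>w. - ext_conj w"])
    fix w assume "w \<in> fibre x"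
    then have w: "w \<noteq> 0" "N w = x" by auto
    then have "\<nu> (- ext_conj w) = \<nu> (ext_of (- 1)) * (\<nu> (ext_of x) / \<nu> w)"
      by (simp add: nu_uminus nu_conj)
    then have "\<nu> (ext_of (- inverse x)) * \<nu> (- ext_conj w)
        = (\<nu> (ext_of (- 1)) * \<nu> (ext_of (- 1))) * (\<nu> (ext_of x) * inverse (\<nu> (ext_of x))) * inverse (\<nu> w)"
      by (simp only: nu_of_minus[of "inverse x"] nu_of_inverse divide_inverse mult_ac)
    moreover have "x \<noteq> 0" using w by auto
    ultimately have "\<nu> (ext_of (- inverse x)) * \<nu> (- ext_conj w) = inverse (\<nu> w)"
      by (simp add: nu_minus_1_square)
    moreover have "ext_trace (- ext_conj w) = - ext_trace w"
      by (simp add: trace_eq ext_conj_def)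
    ultimately show "\<nu> (ext_of (- inverse x)) * (chi (ext_trace (- ext_conj w)) * \<nu> (- ext_conj w))
        = cnj (chi (ext_trace w)) * cnj (\<nu> w)"
      by (simp add: chi_minus cnj_nu)
  qed (auto simp: ext_norm_eq ext_conj_def prod_eq_iff)
  then have "cnj (of_nat q * j x) = \<nu> (ext_of (- inverse x)) * (of_nat q * j x)"
    unfolding bessel_eq by (simp add: sum_distrib_left[symmetric])
  then have "of_nat q * cnj (j x) = of_nat q * (\<nu> (ext_of (- inverse x)) * j x)"
    by (simp add: mult.left_commute)
  then show ?thesis using q_nonzero by (metis mult_left_cancel)
qed

text \<open>The substitution \<open>w\<^sub>2 = s (ext_conj w\<^sub>1)\<close> merges the two exponential sums into
  one in which the argument of \<open>\<nu>\<close> does not depend on \<open>w\<^sub>1\<close>.\<close>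

lemma bessel_product_sum:
  assumes "\<not> decomposable \<eta> \<nu>" and x: "x \<noteq> 0" and y: "y \<noteq> 0"
  shows "(of_nat q)\<^sup>2 * (\<Sum>v\<in>UNIV - {0}. inverse (\<nu> (ext_of v)) * chi (t * v) * (j (x * v) * j (y * v)))
    = \<nu> (ext_of x) * (\<Sum>s\<in>fibre (y / x). \<nu> s *
        (\<Sum>w\<in>UNIV. chi (t / x * N w + ext_trace (w \<odot> (ext_of 1 + ext_conj s)))))"
proof -
  define e where "e w = ext_trace w" for w :: "'a \<times> 'a"
  define h where "h w s = \<nu> (ext_of x) * \<nu> s * chi (t / x * N w + e (w \<odot> (ext_of 1 + ext_conj s)))"
    for w s
  have term_eq: "inverse (\<nu> (ext_of v)) * chi (t * v) * (chi (e w) * \<nu> w) *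
      (chi (e (s \<odot> ext_conj w)) * \<nu> (s \<odot> ext_conj w)) = h w s"
    if "w \<noteq> 0" "N w = x * v" for v w s
  proof -
    \<comment> \<open>The element \<open>w\<close> determines \<open>v\<close>, so the sum over
      \<open>v\<close> and the fibre will become one sum over all nonzero \<open>w\<close>.\<close>
    have v: "v = N w / x" using that x by simp
    have "N w \<noteq> 0" using that(1) by simp
    then have "inverse (\<nu> (ext_of v)) * \<nu> w * \<nu> (s \<odot> ext_conj w) = \<nu> (ext_of x) * \<nu> s"
      using that(1) x by (simp add: v nu_mult nu_conj nu_of_divide)
    moreover have "t * v + e w + e (s \<odot> ext_conj w) = t / x * N w + e (w \<odot> (ext_of 1 + ext_conj s))"
      by (simp add: v e_def trace_eq ext_mult_def ext_of_def ext_conj_def algebra_simps)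
    then have "chi (t * v) * chi (e w) * chi (e (s \<odot> ext_conj w))
        = chi (t / x * N w + e (w \<odot> (ext_of 1 + ext_conj s)))"
      by (simp only: chi_add[symmetric])
    moreover have "inverse (\<nu> (ext_of v)) * chi (t * v) * (chi (e w) * \<nu> w) *
        (chi (e (s \<odot> ext_conj w)) * \<nu> (s \<odot> ext_conj w))
      = (inverse (\<nu> (ext_of v)) * \<nu> w * \<nu> (s \<odot> ext_conj w)) *
        (chi (t * v) * chi (e w) * chi (e (s \<odot> ext_conj w)))"
      by (simp only: mult_ac)
    ultimately show ?thesis unfolding h_def by simp
  qed
  have "(of_nat q)\<^sup>2 * (\<Sum>v\<in>UNIV - {0}. inverse (\<nu> (ext_of v)) * chi (t * v) * (j (x * v) * j (y * v)))
      = (\<Sum>v\<in>UNIV - {0}. inverse (\<nu> (ext_of v)) * chi (t * v) *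
          ((\<Sum>w\<in>fibre (x * v). chi (e w) * \<nu> w) * (\<Sum>z\<in>fibre (y * v). chi (e z) * \<nu> z)))"
    unfolding e_def bessel_eq[symmetric] sum_distrib_left
    by (intro sum.cong) (simp_all only: power2_eq_square mult_ac)
  also have "\<dots> = (\<Sum>v\<in>UNIV - {0}. \<Sum>w\<in>fibre (x * v). \<Sum>s\<in>fibre (y / x). h w s)"
  proof (rule sum.cong)
    fix v :: 'a assume "v \<in> UNIV - {0}"
    have product: "(\<Sum>w\<in>fibre (x * v). chi (e w) * \<nu> w) * (\<Sum>z\<in>fibre (y * v). chi (e z) * \<nu> z)
        = (\<Sum>w\<in>fibre (x * v). (chi (e w) * \<nu> w) *
            (\<Sum>s\<in>fibre (y / x). chi (e (s \<odot> ext_conj w)) * \<nu> (s \<odot> ext_conj w)))"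
      unfolding sum_distrib_right
    proof (rule sum.cong)
      fix w assume "w \<in> fibre (x * v)"
      then show "chi (e w) * \<nu> w * (\<Sum>z\<in>fibre (y * v). chi (e z) * \<nu> z) = (chi (e w) * \<nu> w) *
          (\<Sum>s\<in>fibre (y / x). chi (e (s \<odot> ext_conj w)) * \<nu> (s \<odot> ext_conj w))"
        using sum_fibre_mult[of "ext_conj w" "\<lambda>z. chi (e z) * \<nu> z" "y / x"] x by simp
    qed simp
    show "inverse (\<nu> (ext_of v)) * chi (t * v) *
        ((\<Sum>w\<in>fibre (x * v). chi (e w) * \<nu> w) * (\<Sum>z\<in>fibre (y * v). chi (e z) * \<nu> z))
      = (\<Sum>w\<in>fibre (x * v). \<Sum>s\<in>fibre (y / x). h w s)"
      unfolding product unfolding sum_distrib_left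
    proof (intro sum.cong refl)
      fix w s assume "w \<in> fibre (x * v)"
      then have "w \<noteq> 0" "N w = x * v" by auto
      from term_eq[OF this, of s] show "inverse (\<nu> (ext_of v)) * chi (t * v) * (chi (e w) * \<nu> w *
          (chi (e (s \<odot> ext_conj w)) * \<nu> (s \<odot> ext_conj w))) = h w s"
        by (simp only: mult.assoc)
    qed
  qed simp
  also have "\<dots> = (\<Sum>v\<in>UNIV - {0}. \<Sum>w\<in>fibre v. \<Sum>s\<in>fibre (y / x). h w s)"
    by (rule sum.reindex_bij_witness[of _ "\<lambda>v. v / x" "\<lambda>v. x * v"]) (use x in auto)
  also have "\<dots> = (\<Sum>w\<in>UNIV - {0}. \<Sum>s\<in>fibre (y / x). h w s)"
    by (rule sum_norm_fibres[symmetric])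
  \<comment> \<open>The term at \<open>w = 0\<close> is added to reach a complete exponential sum;
    it costs nothing, being a multiple of the sum of \<nu> over a fibre.\<close>
  also have "\<dots> = (\<Sum>w\<in>UNIV. \<Sum>s\<in>fibre (y / x). h w s) - (\<Sum>s\<in>fibre (y / x). h 0 s)"
    by (simp add: sum_diff1)
  also have "(\<Sum>s\<in>fibre (y / x). h 0 s) = \<nu> (ext_of x) * (\<Sum>s\<in>fibre (y / x). \<nu> s)"
    by (simp add: h_def e_def trace_eq ext_mult_def sum_distrib_left)
  also have "(\<Sum>s\<in>fibre (y / x). \<nu> s) = 0"
    by (rule sum_nu_fibre[OF assms(1)])
  also have "(\<Sum>w\<in>UNIV. \<Sum>s\<in>fibre (y / x). h w s) = (\<Sum>s\<in>fibre (y / x). \<Sum>w\<in>UNIV. h w s)"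
    by (rule sum.swap)
  finally show ?thesis
    by (simp add: h_def e_def sum_distrib_left mult.assoc)
qed

text \<open>The case \<open>t = 0\<close> of the product sum: the inner sum is linear in
  \<open>w\<close> and survives only at s = -1, an element of norm 1, which lies in the fibre over
  \<open>y / x\<close> exactly when \<open>x = y\<close>.\<close>

lemma bessel_orthogonality:
  assumes "\<not> decomposable \<eta> \<nu>" and x: "x \<noteq> 0" and y: "y \<noteq> 0"
  shows "(\<Sum>v\<in>UNIV - {0}. inverse (\<nu> (ext_of v)) * (j (x * v) * j (y * v)))
    = \<nu> (ext_of (- x)) * of_bool (x = y)"
proof -
  have s0: "ext_of 1 + ext_conj s = 0 \<longleftrightarrow> s = ext_of (- 1)" for s :: "'a \<times> 'a"
    by (auto simp: ext_of_def ext_conj_def prod_eq_iff add_eq_0_iff minus_equation_iff[of 1])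
  have "(of_nat q)\<^sup>2 * (\<Sum>v\<in>UNIV - {0}. inverse (\<nu> (ext_of v)) * (j (x * v) * j (y * v)))
      = \<nu> (ext_of x) * (\<Sum>s\<in>fibre (y / x). \<nu> s * ((of_nat q)\<^sup>2 * of_bool (s = ext_of (- 1))))"
    using bessel_product_sum[OF assms, of 0] by (simp add: sum_chi_trace s0)
  also have "(\<Sum>s\<in>fibre (y / x). \<nu> s * ((of_nat q)\<^sup>2 * of_bool (s = ext_of (- 1))))
      = (\<Sum>s\<in>fibre (y / x). if s = ext_of (- 1) then \<nu> s * (of_nat q)\<^sup>2 else 0)"
    by (intro sum.cong) auto
  also have "\<dots> = (if ext_of (- 1) \<in> fibre (y / x) then \<nu> (ext_of (- 1)) * (of_nat q)\<^sup>2 else 0)"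
    by (rule sum.delta) simp
  also have "ext_of (- 1) \<in> fibre (y / x) \<longleftrightarrow> x = y"
    using x y by (auto simp: field_simps)
  finally show ?thesis
    using nu_of_minus[of x] by (simp add: q_eq split: if_splits)
qed

text \<open>For nonzero \<open>t\<close> the inner sum is a Gauss sum. Expanding the norm of 1 +
  conj s leaves a phase linear in the trace of \<open>s\<close>, so the sum over \<open>s\<close> is
  again a Bessel sum.\<close>

lemma bessel_convolution:
  assumes "\<not> decomposable \<eta> \<nu>" and x: "x \<noteq> 0" and y: "y \<noteq> 0" and t: "t \<noteq> 0"
  shows "(\<Sum>v\<in>UNIV - {0}. inverse (\<nu> (ext_of v)) * chi (t * v) * (j (x * v) * j (y * v)))
    = - \<nu> (ext_of (- t)) * chi (- (x + y) / t) * j (x * y / t\<^sup>2)"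
proof -
  \<comment> \<open>The scalar that absorbs the remaining phase: the trace of
    \<open>s \<odot> r\<close> is \<open>- x / t\<close> times the trace of
    \<open>s\<close>.\<close>
  define r where "r = ext_of (- x / t)"
  have r: "r \<noteq> 0" using x t by (simp add: r_def)
  have fibre: "y / x * N r = x * y / t\<^sup>2"
    using x by (simp add: r_def power2_eq_square)
  have summand: "\<nu> (ext_of x) * (\<nu> s * chi (- N (ext_of 1 + ext_conj s) / (t / x)))
      = \<nu> (ext_of (- t)) * chi (- (x + y) / t) * (chi (ext_trace (s \<odot> r)) * \<nu> (s \<odot> r))"
    if "N s = y / x" for s
  proof -
    have "- N (ext_of 1 + ext_conj s) / (t / x) = - (x + x * N s + x * ext_trace s) / t"
      using t x by (simp add: ext_norm_eq trace_eq ext_of_def ext_conj_def power2_eq_square algebra_simps)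
    also have "\<dots> = - (x + y) / t + ext_trace (s \<odot> r)"
      using that x t by (simp add: r_def trace_eq ext_mult_def ext_of_def field_simps)
    finally have "chi (- N (ext_of 1 + ext_conj s) / (t / x)) = chi (- (x + y) / t) * chi (ext_trace (s \<odot> r))"
      by (simp only: chi_add)
    moreover have "\<nu> (ext_of (- t)) * \<nu> r = \<nu> (ext_of x)"
      using t by (simp add: r_def nu_of_mult[symmetric])
    then have "\<nu> (ext_of (- t)) * \<nu> (s \<odot> r) = \<nu> (ext_of x) * \<nu> s"
      by (metis nu_mult mult.left_commute mult.commute)
    moreover have "\<nu> (ext_of (- t)) * chi (- (x + y) / t) * (chi (ext_trace (s \<odot> r)) * \<nu> (s \<odot> r))
        = (\<nu> (ext_of (- t)) * \<nu> (s \<odot> r)) * (chi (- (x + y) / t) * chi (ext_trace (s \<odot> r)))"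
      by (simp only: mult_ac)
    ultimately show ?thesis by (simp only: mult.assoc)
  qed
  have "(of_nat q)\<^sup>2 * (\<Sum>v\<in>UNIV - {0}. inverse (\<nu> (ext_of v)) * chi (t * v) * (j (x * v) * j (y * v)))
      = - of_nat q * (\<Sum>s\<in>fibre (y / x). \<nu> (ext_of x) * (\<nu> s * chi (- N (ext_of 1 + ext_conj s) / (t / x))))"
    using x t by (subst bessel_product_sum[OF assms(1-3)], subst gauss_sum)
      (simp_all add: sum_distrib_left mult_ac sum_negf)
  also have "(\<Sum>s\<in>fibre (y / x). \<nu> (ext_of x) * (\<nu> s * chi (- N (ext_of 1 + ext_conj s) / (t / x))))
      = \<nu> (ext_of (- t)) * chi (- (x + y) / t) *
        (\<Sum>s\<in>fibre (y / x). chi (ext_trace (s \<odot> r)) * \<nu> (s \<odot> r))"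
    unfolding sum_distrib_left by (rule sum.cong) (auto simp only: summand)
  also have "(\<Sum>s\<in>fibre (y / x). chi (ext_trace (s \<odot> r)) * \<nu> (s \<odot> r)) = of_nat q * j (x * y / t\<^sup>2)"
    using sum_fibre_mult[OF r, of "\<lambda>z. chi (ext_trace z) * \<nu> z" "y / x"]
    unfolding fibre bessel_eq by simp
  also have "- of_nat q * (\<nu> (ext_of (- t)) * chi (- (x + y) / t) * (of_nat q * j (x * y / t\<^sup>2)))
      = (of_nat q)\<^sup>2 * (- \<nu> (ext_of (- t)) * chi (- (x + y) / t) * j (x * y / t\<^sup>2))"
    by (simp add: power2_eq_square)
  finally show ?thesis
    by (rule mult_left_cancel[THEN iffD1, rotated]) (simp add: q_eq)
qed

section \<open>The cuspidal representation on the Cartan subgroup\<close>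

text \<open>The matrix entry in row \<open>u\<close> and column \<open>v\<close> of the operator by
  which the Cartan element \<open>w\<close> acts. The first branch belongs to the scalar
  matrices.\<close>

definition kernel :: "'a \<times> 'a \<Rightarrow> 'a \<Rightarrow> 'a \<Rightarrow> complex" where
  "kernel w u v =
    (if snd w = 0 then \<nu> (ext_of (fst w)) * of_bool (u = v)
     else - \<nu> (ext_of (- snd w * v)) * chi (fst w / snd w * (1 / u + 1 / v))
       * j (N w / ((snd w)\<^sup>2 * u * v)))"

lemma cuspidal_rep_cartan:
  assumes "y \<noteq> 0"
  shows "cuspidal_rep \<eta> chi \<nu> (cartan_mat \<eta> w) f y = (\<Sum>v\<in>UNIV - {0}. kernel w y v * f v)"
proof (cases "snd w = 0")
  case True
  have "(\<Sum>v\<in>UNIV - {0}. kernel w y v * f v)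
      = (\<Sum>v\<in>UNIV - {0}. if y = v then \<nu> (ext_of (fst w)) * f v else 0)"
    using True by (intro sum.cong) (auto simp: kernel_def)
  also have "\<dots> = \<nu> (ext_of (fst w)) * f y"
    using assms by (subst sum.delta') auto
  finally show ?thesis
    using assms True
    by (cases "fst w = 0") (auto simp: cuspidal_rep_def cartan_mat_def mat2_def vector_2 Let_def)
next
  case False
  have "det (cartan_mat \<eta> w) = N w"
    by (simp add: cartan_mat_def mat2_def det_2 ext_norm_eq power2_eq_square)
  moreover have "inverse ((snd w)\<^sup>2) * inverse y * inverse x * N w = N w / ((snd w)\<^sup>2 * y * x)" for x
    by (simp add: divide_inverse)
  moreover have "fst w * inverse (snd w) * inverse y + inverse (snd w) * fst w * inverse x
      = fst w / snd w * (1 / y + 1 / x)" for x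
    by (simp add: divide_inverse algebra_simps)
  ultimately show ?thesis
    using assms False unfolding cuspidal_rep_def Let_def
    by (simp add: cartan_mat_def mat2_def vector_2 kernel_def sum_negf[symmetric])
qed

section \<open>Multiplicativity, unitarity and trace of the kernels\<close>

lemma kernel_of: "kernel (ext_of a) u v = \<nu> (ext_of a) * of_bool (u = v)"
  by (simp add: kernel_def) (simp add: ext_of_def)

lemma kernel_slope: "kernel (\<alpha>, 1) u v =
    - \<nu> (ext_of (- v)) * chi (\<alpha> * (1 / u + 1 / v)) * j ((\<alpha>\<^sup>2 - \<eta>) / (u * v))"
  by (simp add: kernel_def ext_norm_eq)

text \<open>Scalars act through the central character: the slope \<open>fst w / snd w\<close> and
  the ratio of \<open>N w\<close> to \<open>(snd w)\<^sup>2\<close> are homogeneous of degree 0.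
  This reduces statements about kernels to scalars and to slopes
  \<open>(\<gamma>, 1)\<close>.\<close>

lemma kernel_scale:
  assumes "a \<noteq> 0"
  shows "kernel (ext_of a \<odot> w) u v = \<nu> (ext_of a) * kernel w u v"
proof -
  have [simp]: "fst (ext_of a \<odot> w) = a * fst w" "snd (ext_of a \<odot> w) = a * snd w"
    by (simp_all add: ext_mult_def ext_of_def)
  have "\<nu> (ext_of (- (a * snd w * v))) = \<nu> (ext_of a) * \<nu> (ext_of (- (snd w * v)))"
    by (simp add: nu_of_mult[symmetric] mult.assoc)
  moreover have "N (ext_of a \<odot> w) / ((a * snd w)\<^sup>2 * u * v) = N w / ((snd w)\<^sup>2 * u * v)"
    using assms by (simp add: ext_norm_mult power_mult_distrib mult.assoc)
  ultimately show ?thesis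
    using assms by (simp add: kernel_def nu_of_mult)
qed

lemma polar_cases:
  assumes "w \<noteq> 0"
  obtains a where "a \<noteq> 0" "w = ext_of a"
  | b \<gamma> where "b \<noteq> 0" "w = ext_of b \<odot> (\<gamma>, 1)"
proof (cases "snd w = 0")
  case True
  then have "w = ext_of (fst w)" by (simp add: ext_of_def prod_eq_iff)
  then show thesis using that(1)[of "fst w"] assms by (metis ext_of_0)
next
  case False
  then have "w = ext_of (snd w) \<odot> (fst w / snd w, 1)"
    by (simp add: ext_of_def ext_mult_def prod_eq_iff)
  then show thesis using that(2)[of "snd w"] False by blast
qed

lemma slope_nonzero [simp]: "(\<gamma>, 1) \<noteq> (0 :: 'a \<times> 'a)"
  by (simp add: prod_eq_iff)

lemma slope_norm: "\<gamma>\<^sup>2 - \<eta> \<noteq> 0"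
  using ext_norm_eq_0_iff[of "(\<gamma>, 1)"] by (simp add: ext_norm_eq del: ext_norm_eq_0_iff)

text \<open>The product of two kernels is a Bessel product sum with frequency \<alpha> + \<beta>. If
  this vanishes, the product of the two elements is a scalar and orthogonality applies; otherwise
  the convolution formula does.\<close>

lemma kernel_mult_slopes:
  assumes ind: "\<not> decomposable \<eta> \<nu>" and u: "u \<noteq> 0" and t: "t \<noteq> 0"
  shows "(\<Sum>v\<in>UNIV - {0}. kernel (\<alpha>, 1) u v * kernel (\<beta>, 1) v t) = kernel ((\<alpha>, 1) \<odot> (\<beta>, 1)) u t"
proof -
  \<comment> \<open>\<open>A\<close> and \<open>B\<close> are the norms of \<alpha> + i and \<beta>
    + i, and \<open>s\<close> is the coefficient of i in their product.\<close>
  define A B s where "A = \<alpha>\<^sup>2 - \<eta>" and "B = \<beta>\<^sup>2 - \<eta>" and "s = \<alpha> + \<beta>"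
  have A: "A \<noteq> 0" and B: "B \<noteq> 0" unfolding A_def B_def by (rule slope_norm)+
  have mult: "(\<alpha>, 1) \<odot> (\<beta>, 1) = (\<alpha> * \<beta> + \<eta>, s)"
    by (simp add: ext_mult_def s_def)
  \<comment> \<open>Replacing \<open>v\<close> by its inverse makes the phase and the arguments of
    \<open>j\<close> linear in \<open>v\<close>.\<close>
  have "(\<Sum>v\<in>UNIV - {0}. kernel (\<alpha>, 1) u v * kernel (\<beta>, 1) v t)
      = (\<Sum>v\<in>UNIV - {0}. \<nu> (ext_of t) * chi (\<alpha> / u + \<beta> / t) *
          (inverse (\<nu> (ext_of v)) * chi (s * v) * (j (A / u * v) * j (B / t * v))))"
  proof (rule sum.reindex_bij_witness[of _ inverse inverse])
    fix v :: 'a assume "v \<in> UNIV - {0}"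
    then have v: "v \<noteq> 0" by simp
    have "\<nu> (ext_of (- v)) * \<nu> (ext_of (- t)) = \<nu> (ext_of t) * inverse (\<nu> (ext_of (inverse v)))"
      by (simp add: nu_of_mult[symmetric] nu_of_inverse mult.commute)
    moreover have "chi (\<alpha> * (1 / u + 1 / v)) * chi (\<beta> * (1 / v + 1 / t))
        = chi (\<alpha> / u + \<beta> / t) * chi (s * inverse v)"
      by (simp add: chi_add[symmetric] s_def divide_inverse algebra_simps)
    moreover have "A / (u * v) = A / u * inverse v" "B / (v * t) = B / t * inverse v"
      by (simp_all add: divide_inverse)
    moreover have "kernel (\<alpha>, 1) u v * kernel (\<beta>, 1) v t = (\<nu> (ext_of (- v)) * \<nu> (ext_of (- t))) *
        (chi (\<alpha> * (1 / u + 1 / v)) * chi (\<beta> * (1 / v + 1 / t))) * (j (A / (u * v)) * j (B / (v * t)))"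
      unfolding kernel_slope A_def B_def minus_mult_minus by (simp add: mult_ac)
    ultimately show "\<nu> (ext_of t) * chi (\<alpha> / u + \<beta> / t) *
          (inverse (\<nu> (ext_of (inverse v))) * chi (s * inverse v) * (j (A / u * inverse v) * j (B / t * inverse v)))
        = kernel (\<alpha>, 1) u v * kernel (\<beta>, 1) v t"
      by (simp only: mult_ac)
  qed auto
  also have "\<dots> = \<nu> (ext_of t) * chi (\<alpha> / u + \<beta> / t) *
      (\<Sum>v\<in>UNIV - {0}. inverse (\<nu> (ext_of v)) * chi (s * v) * (j (A / u * v) * j (B / t * v)))"
    by (rule sum_distrib_left[symmetric])
  also have "\<dots> = kernel (\<alpha> * \<beta> + \<eta>, s) u t"
  proof (cases "s = 0")
    case True
    then have \<beta>: "\<beta> = - \<alpha>" by (simp add: s_def add_eq_0_iff)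
    \<comment> \<open>Here \<beta> = -\<alpha> forces \<open>A = B\<close>, so the delta of the
      orthogonality relation becomes that of a scalar kernel.\<close>
    have AB: "A / u = B / t \<longleftrightarrow> u = t"
      using A u t by (auto simp: A_def B_def \<beta> field_simps)
    have "\<nu> (ext_of t) * \<nu> (ext_of (- (A / t))) = \<nu> (ext_of (\<alpha> * \<beta> + \<eta>))"
      using t by (simp add: nu_of_mult[symmetric] A_def \<beta> power2_eq_square)
    then show ?thesis
      using bessel_orthogonality[OF ind, of "A / u" "B / t"] A B u t True AB
      by (auto simp: kernel_def \<beta>)
  next
    case False
    have nu: "\<nu> (ext_of t) * \<nu> (ext_of (- s)) = \<nu> (ext_of (- s * t))"
      by (simp add: nu_of_mult[symmetric] mult.commute)
    \<comment> \<open>Both corrected slopes coincide with the slope of the product; this matches the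
      phases on the two sides.\<close>
    have "\<alpha> - A / s = (\<alpha> * \<beta> + \<eta>) / s" "\<beta> - B / s = (\<alpha> * \<beta> + \<eta>) / s"
      using False by (simp_all add: A_def B_def s_def field_simps power2_eq_square)
    then have "(\<alpha> - A / s) / u + (\<beta> - B / s) / t = (\<alpha> * \<beta> + \<eta>) / s * (1 / u + 1 / t)"
      by (simp add: distrib_left)
    moreover have "\<alpha> / u + \<beta> / t + - (A / u + B / t) / s = (\<alpha> - A / s) / u + (\<beta> - B / s) / t"
      by (simp add: diff_divide_distrib add_divide_distrib mult.commute)
    ultimately have "\<alpha> / u + \<beta> / t + - (A / u + B / t) / s = (\<alpha> * \<beta> + \<eta>) / s * (1 / u + 1 / t)"
      by simp
    then have "chi (\<alpha> / u + \<beta> / t) * chi (- (A / u + B / t) / s) = chi ((\<alpha> * \<beta> + \<eta>) / s * (1 / u + 1 / t))"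
      by (simp only: chi_add[symmetric])
    moreover have "N (\<alpha> * \<beta> + \<eta>, s) = A * B"
      unfolding mult[symmetric] ext_norm_mult by (simp add: ext_norm_eq A_def B_def)
    then have "A / u * (B / t) / s\<^sup>2 = N (\<alpha> * \<beta> + \<eta>, s) / (s\<^sup>2 * u * t)"
      by (simp add: mult_ac)
    moreover have "\<nu> (ext_of t) * chi (\<alpha> / u + \<beta> / t) *
          (- \<nu> (ext_of (- s)) * chi (- (A / u + B / t) / s) * j (A / u * (B / t) / s\<^sup>2))
        = - (\<nu> (ext_of t) * \<nu> (ext_of (- s))) * (chi (\<alpha> / u + \<beta> / t) * chi (- (A / u + B / t) / s))
          * j (A / u * (B / t) / s\<^sup>2)"
      by (simp only: mult_minus_left mult_minus_right mult_ac)
    moreover have "kernel (\<alpha> * \<beta> + \<eta>, s) u t = - \<nu> (ext_of (- s * t))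
        * chi ((\<alpha> * \<beta> + \<eta>) / s * (1 / u + 1 / t)) * j (N (\<alpha> * \<beta> + \<eta>, s) / (s\<^sup>2 * u * t))"
      using False by (simp add: kernel_def)
    moreover have "A / u \<noteq> 0" "B / t \<noteq> 0" using A B u t by simp_all
    note bessel_convolution[OF ind this False]
    ultimately show ?thesis
      by (simp only: nu)
  qed
  finally show ?thesis by (simp add: mult)
qed

text \<open>A scalar factor has a diagonal kernel and only rescales the other one; two non-scalar
  factors reduce to their slopes.\<close>

lemma kernel_mult:
  assumes ind: "\<not> decomposable \<eta> \<nu>" and w: "w \<noteq> 0" and z: "z \<noteq> 0" and u: "u \<noteq> 0" and t: "t \<noteq> 0"
  shows "(\<Sum>v\<in>UNIV - {0}. kernel w u v * kernel z v t) = kernel (w \<odot> z) u t"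
  using w
proof (cases w rule: polar_cases)
  case (1 a)
  have "(\<Sum>v\<in>UNIV - {0}. kernel w u v * kernel z v t)
      = (\<Sum>v\<in>UNIV - {0}. if u = v then \<nu> (ext_of a) * kernel z v t else 0)"
    unfolding 1 kernel_of by (intro sum.cong) auto
  also have "\<dots> = \<nu> (ext_of a) * kernel z u t"
    using u by (subst sum.delta') auto
  finally show ?thesis using 1 kernel_scale by simp
next
  case w: (2 b \<alpha>)
  show ?thesis
    using z
  proof (cases z rule: polar_cases)
    case (1 a)
    have "(\<Sum>v\<in>UNIV - {0}. kernel w u v * kernel z v t)
        = (\<Sum>v\<in>UNIV - {0}. if v = t then \<nu> (ext_of a) * kernel w u v else 0)"
      unfolding 1 kernel_of by (intro sum.cong) auto
    also have "\<dots> = \<nu> (ext_of a) * kernel w u t"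
      using t by (subst sum.delta) auto
    finally show ?thesis using 1 kernel_scale ext_mult_commute[of \<eta> w] by simp
  next
    case z: (2 c \<beta>)
    have "w \<odot> z = ext_of b \<odot> (ext_of c \<odot> ((\<alpha>, 1) \<odot> (\<beta>, 1)))"
      unfolding w z by (metis ext_mult_assoc ext_mult_commute)
    then have "kernel (w \<odot> z) u t = \<nu> (ext_of b) * (\<nu> (ext_of c) * kernel ((\<alpha>, 1) \<odot> (\<beta>, 1)) u t)"
      using w z by (simp add: kernel_scale)
    also have "\<dots> = (\<Sum>v\<in>UNIV - {0}. kernel w u v * kernel z v t)"
      using w z by (simp add: kernel_mult_slopes[OF ind u t, symmetric] kernel_scale sum_distrib_left mult_ac)
    finally show ?thesis ..
  qed
qed

text \<open>Unitarity of the action: the adjoint of the operator of \<open>w\<close> is that of its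
  inverse. For scalars it is conjugation of \<nu>, for slopes it comes from
  \<open>cnj_bessel\<close>.\<close>

lemma cnj_kernel:
  assumes w: "w \<noteq> 0" and u: "u \<noteq> 0" and v: "v \<noteq> 0"
  shows "cnj (kernel w u v) = kernel (einv w) v u"
  using w
proof (cases w rule: polar_cases)
  case (1 a)
  have "einv w = ext_of (inverse a)"
    using 1 by (simp add: einv_def mul_of_of) (simp add: ext_of_def ext_conj_def ext_mult_def power2_eq_square)
  then show ?thesis
    using 1 by (auto simp: kernel_of cnj_nu nu_of_inverse)
next
  case (2 b \<gamma>)
  define M where "M = \<gamma>\<^sup>2 - \<eta>"
  have M: "M \<noteq> 0" unfolding M_def by (rule slope_norm)
  have "N w = b\<^sup>2 * M"
    unfolding 2 ext_norm_mult by (simp add: ext_norm_eq M_def ext_of_def)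
  \<comment> \<open>The inverse is put in polar form again, with slope -\<gamma>, so that
    \<open>kernel_scale\<close> and \<open>kernel_slope\<close> apply.\<close>
  then have "einv w = ext_of (- inverse (b * M)) \<odot> (- \<gamma>, 1)"
    using 2 M by (simp add: einv_def ext_of_def ext_conj_def ext_mult_def field_simps power2_eq_square)
  then have inv: "kernel (einv w) v u = - (\<nu> (ext_of (- inverse (b * M))) * \<nu> (ext_of (- u)))
      * chi (- \<gamma> * (1 / v + 1 / u)) * j (M / (v * u))"
    using 2 M by (simp add: kernel_scale kernel_slope M_def)
  have "\<nu> (ext_of (- inverse (b * M))) * \<nu> (ext_of (- u))
      = inverse (\<nu> (ext_of b)) * inverse (\<nu> (ext_of (- v))) * \<nu> (ext_of (- inverse (M / (u * v))))"
  proof -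
    have "- inverse (b * M) * - u = inverse b * inverse (- v) * - inverse (M / (u * v))"
      using v by (simp add: divide_inverse)
    then show ?thesis by (simp only: nu_of_mult[symmetric] nu_of_inverse[symmetric])
  qed
  moreover have "cnj (chi (\<gamma> * (1 / u + 1 / v))) = chi (- \<gamma> * (1 / v + 1 / u))"
    by (simp add: chi_minus[symmetric] add.commute)
  ultimately show ?thesis
    unfolding inv unfolding 2 kernel_scale[OF 2(1)] kernel_slope M_def[symmetric]
    by (simp add: cnj_nu cnj_bessel mult_ac)
qed

text \<open>Expanding \<open>j\<close> on the diagonal and summing over \<open>u\<close> first
  detects the elements of norm \<gamma>^2 - \<eta> and trace 2\<gamma>, which are \<gamma> + i and
  \<gamma> - i.\<close>

lemma kernel_trace:
  assumes "\<not> decomposable \<eta> \<nu>"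
  shows "(\<Sum>u\<in>UNIV - {0}. kernel (\<gamma>, 1) u u) = - (\<nu> (\<gamma>, 1) + \<nu> (\<gamma>, - 1))"
proof -
  define M where "M = \<gamma>\<^sup>2 - \<eta>"
  have diag: "of_nat q * kernel (\<gamma>, 1) u u
      = - (\<Sum>r\<in>fibre M. \<nu> r * chi ((2 * \<gamma> - ext_trace r) / u))"
    if "u \<noteq> 0" for u
  proof -
    \<comment> \<open>Scaling by this element moves the dependence on \<open>u\<close> from the
      fibre into the phase and cancels the factor \<open>\<nu> (ext_of (- u))\<close>.\<close>
    define c where "c = ext_of (- inverse u)"
    have c: "c \<noteq> 0" using that by (simp add: c_def)
    have fibre: "M / (u * u) = M * N c" by (simp add: c_def power2_eq_square divide_inverse)
    have "of_nat q * kernel (\<gamma>, 1) u u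
        = - (\<nu> (ext_of (- u)) * chi (\<gamma> * (1 / u + 1 / u)) * (of_nat q * j (M / (u * u))))"
      by (simp add: kernel_slope M_def)
    also have "of_nat q * j (M / (u * u)) = (\<Sum>r\<in>fibre M. chi (ext_trace (r \<odot> c)) * \<nu> (r \<odot> c))"
      unfolding bessel_eq fibre by (rule sum_fibre_mult[OF c])
    also have "\<nu> (ext_of (- u)) * chi (\<gamma> * (1 / u + 1 / u)) * \<dots>
        = (\<Sum>r\<in>fibre M. \<nu> r * chi ((2 * \<gamma> - ext_trace r) / u))"
      unfolding sum_distrib_left
    proof (rule sum.cong)
      fix r
      have "\<nu> (ext_of (- u)) * \<nu> c = 1"
        using that by (simp add: c_def nu_of_mult[symmetric])
      moreover have "chi (\<gamma> * (1 / u + 1 / u)) * chi (ext_trace (r \<odot> c)) = chi ((2 * \<gamma> - ext_trace r) / u)"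
        by (simp add: chi_add[symmetric] c_def trace_eq ext_mult_def ext_of_def divide_inverse algebra_simps)
      moreover have "\<nu> (ext_of (- u)) * chi (\<gamma> * (1 / u + 1 / u)) * (chi (ext_trace (r \<odot> c)) * \<nu> (r \<odot> c))
          = (\<nu> (ext_of (- u)) * \<nu> c) * \<nu> r * (chi (\<gamma> * (1 / u + 1 / u)) * chi (ext_trace (r \<odot> c)))"
        by (simp add: nu_mult mult_ac)
      ultimately show "\<nu> (ext_of (- u)) * chi (\<gamma> * (1 / u + 1 / u)) * (chi (ext_trace (r \<odot> c)) * \<nu> (r \<odot> c))
          = \<nu> r * chi ((2 * \<gamma> - ext_trace r) / u)"
        by simp
    qed simp
    finally show ?thesis .
  qed
  have "of_nat q * (\<Sum>u\<in>UNIV - {0}. kernel (\<gamma>, 1) u u)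
      = - (\<Sum>u\<in>UNIV - {0}. \<Sum>r\<in>fibre M. \<nu> r * chi ((2 * \<gamma> - ext_trace r) / u))"
    by (simp add: sum_distrib_left diag sum_negf)
  also have "(\<Sum>u\<in>UNIV - {0}. \<Sum>r\<in>fibre M. \<nu> r * chi ((2 * \<gamma> - ext_trace r) / u))
      = (\<Sum>r\<in>fibre M. \<nu> r * (of_nat q * of_bool (2 * \<gamma> - ext_trace r = 0) - 1))"
    by (subst sum.swap) (simp only: sum_distrib_left[symmetric] sum_chi_divide)
  also have "\<dots> = of_nat q * (\<Sum>r\<in>fibre M. \<nu> r * of_bool (2 * \<gamma> - ext_trace r = 0)) - (\<Sum>r\<in>fibre M. \<nu> r)"
    by (simp only: right_diff_distrib mult_1_right sum_subtractf sum_distrib_left mult.left_commute)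
  also have "(\<Sum>r\<in>fibre M. \<nu> r) = 0"
    by (rule sum_nu_fibre[OF assms])
  also have "(\<Sum>r\<in>fibre M. \<nu> r * of_bool (2 * \<gamma> - ext_trace r = 0)) = (\<Sum>r\<in>{(\<gamma>, 1), (\<gamma>, - 1)}. \<nu> r)"
  proof (rule sum.mono_neutral_cong_right)
    have "r \<in> {(\<gamma>, 1), (\<gamma>, - 1)}" if "N r = M" "2 * \<gamma> - ext_trace r = 0" for r
    proof -
      have "fst r = \<gamma>" using that(2) two_neq_0 by (simp add: trace_eq)
      then have "(snd r)\<^sup>2 = 1" using that(1) eta_neq_0 by (simp add: ext_norm_eq M_def)
      then show ?thesis using \<open>fst r = \<gamma>\<close> by (auto simp: prod_eq_iff power2_eq_1_iff)
    qed
    then show "\<forall>r\<in>fibre M - {(\<gamma>, 1), (\<gamma>, - 1)}. \<nu> r * of_bool (2 * \<gamma> - ext_trace r = 0) = 0"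
      by auto
  qed (auto simp: ext_norm_eq M_def trace_eq prod_eq_iff)
  also have "(\<Sum>r\<in>{(\<gamma>, 1), (\<gamma>, - 1)}. \<nu> r) = \<nu> (\<gamma>, 1) + \<nu> (\<gamma>, - 1)"
  proof -
    \<comment> \<open>Odd characteristic keeps the two elements distinct, so the sum over the set
      really has two terms.\<close>
    have "(1::'a) + 1 \<noteq> 0" using two_neq_0 by simp
    then have "(1::'a) \<noteq> - 1" by (metis add.right_inverse)
    then show ?thesis by simp
  qed
  finally have "of_nat q * (\<Sum>u\<in>UNIV - {0}. kernel (\<gamma>, 1) u u) = of_nat q * - (\<nu> (\<gamma>, 1) + \<nu> (\<gamma>, - 1))"
    by (simp add: algebra_simps)
  then show ?thesis using q_nonzero by (metis mult_left_cancel)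
qed

end

section \<open>The projection onto the spherical vector\<close>

context quadratic_extension
begin

text \<open>Translation by an element \<open>z\<close> where the characters differ multiplies the
  sum by \<open>\<mu> z / \<kappa> z\<close>, which is not 1.\<close>

lemma ext_character_orthogonality:
  assumes "\<mu> \<in> ext_characters \<eta>" and "\<kappa> \<in> ext_characters \<eta>" and "\<mu> \<noteq> \<kappa>"
  shows "(\<Sum>w\<in>UNIV - {0}. cnj (\<kappa> w) * \<mu> w) = 0"
proof -
  interpret \<mu>: ext_character \<eta> chi q \<mu> by unfold_locales (rule assms)
  interpret \<kappa>: ext_character \<eta> chi q \<kappa> by unfold_locales (rule assms)
  obtain z where z: "\<mu> z \<noteq> \<kappa> z" using assms(3) by blast
  then have z0: "z \<noteq> 0" by auto
  define S where "S = (\<Sum>w\<in>UNIV - {0}. cnj (\<kappa> w) * \<mu> w)"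
  have "S = (\<Sum>w\<in>UNIV - {0}. cnj (\<kappa> (z \<odot> w)) * \<mu> (z \<odot> w))"
    unfolding S_def by (rule sum_mult_shift[OF z0, symmetric])
  also have "\<dots> = (cnj (\<kappa> z) * \<mu> z) * S"
    unfolding S_def sum_distrib_left by (simp add: \<kappa>.nu_mult \<mu>.nu_mult mult_ac)
  finally have "S = \<mu> z / \<kappa> z * S"
    by (simp add: \<kappa>.cnj_nu divide_inverse mult.commute)
  then have "(\<mu> z / \<kappa> z - 1) * S = 0" by (simp add: left_diff_distrib)
  moreover have "\<mu> z / \<kappa> z - 1 \<noteq> 0" using z z0 by (simp add: field_simps)
  ultimately show ?thesis unfolding S_def by (simp only: mult_eq_0_iff simp_thms)
qed

end

text \<open>Subtracting the projection onto \<open>f\<close> from \<open>P\<close> leaves a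
  Hermitian idempotent \<open>Q\<close> of trace 1 - 1 = 0. The trace of its square is the sum of
  the squared absolute values of its entries, so \<open>Q\<close> vanishes.\<close>

lemma rank_one_projection:
  fixes P :: "'b \<Rightarrow> 'b \<Rightarrow> complex"
  assumes "finite U"
    and herm: "\<And>u v. u \<in> U \<Longrightarrow> v \<in> U \<Longrightarrow> cnj (P u v) = P v u"
    and idem: "\<And>u v. u \<in> U \<Longrightarrow> v \<in> U \<Longrightarrow> (\<Sum>s\<in>U. P u s * P s v) = P u v"
    and trace: "(\<Sum>u\<in>U. P u u) = 1"
    and fixed: "\<And>u. u \<in> U \<Longrightarrow> (\<Sum>v\<in>U. P u v * f v) = f u"
    and unit: "(\<Sum>u\<in>U. f u * cnj (f u)) = 1"
    and "u \<in> U" "v \<in> U"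
  shows "P u v = f u * cnj (f v)"
proof -
  \<comment> \<open>The adjoint of the equation \<open>fixed\<close>, obtained from the Hermitian
    symmetry of \<open>P\<close>.\<close>
  have fixed': "(\<Sum>s\<in>U. cnj (f s) * P s v) = cnj (f v)" if "v \<in> U" for v
    using arg_cong[OF fixed[OF that], of cnj] that herm by (simp add: mult.commute)
  define Q where "Q u v = P u v - f u * cnj (f v)" for u v
  have Q_herm: "cnj (Q u v) = Q v u" if "u \<in> U" "v \<in> U" for u v
    using herm[OF that] by (simp add: Q_def mult.commute)
  have "(\<Sum>s\<in>U. Q u s * Q s u) = Q u u" if u: "u \<in> U" for u
  proof -
    have "(\<Sum>s\<in>U. Q u s * Q s u) = (\<Sum>s\<in>U. P u s * P s u) - (\<Sum>s\<in>U. P u s * f s) * cnj (f u)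
        - f u * (\<Sum>s\<in>U. cnj (f s) * P s u) + f u * (\<Sum>s\<in>U. f s * cnj (f s)) * cnj (f u)"
      unfolding sum_distrib_left sum_distrib_right sum_subtractf[symmetric] sum.distrib[symmetric]
      by (intro sum.cong) (simp_all add: Q_def algebra_simps)
    then show ?thesis
      using u by (simp add: idem fixed fixed' unit Q_def)
  qed
  then have "(\<Sum>u\<in>U. \<Sum>s\<in>U. Q u s * Q s u) = (\<Sum>u\<in>U. Q u u)"
    by simp
  also have "\<dots> = 0"
    by (simp add: Q_def sum_subtractf trace unit)
  also have "(\<Sum>u\<in>U. \<Sum>s\<in>U. Q u s * Q s u) = (\<Sum>u\<in>U. \<Sum>s\<in>U. of_real ((cmod (Q u s))\<^sup>2))"
    by (intro sum.cong) (simp_all only: complex_norm_square Q_herm)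
  finally have "(\<Sum>u\<in>U. \<Sum>s\<in>U. (cmod (Q u s))\<^sup>2) = 0"
    unfolding of_real_sum[symmetric] of_real_eq_0_iff .
  then have "Q u v = 0"
    using assms(1,7,8) by (simp add: sum_nonneg_eq_0_iff sum_nonneg)
  then show ?thesis by (simp add: Q_def)
qed

locale spherical_pair = ext_character \<eta> chi q \<nu> + nu0: ext_character \<eta> chi q \<nu>\<^sub>0
  for \<eta> :: "'a::{field,finite}" and chi :: "'a \<Rightarrow> complex" and q :: nat
    and \<nu> \<nu>\<^sub>0 :: "'a \<times> 'a \<Rightarrow> complex" +
  assumes indecomposable: "\<not> decomposable \<eta> \<nu>"
    and sharp_eq: "sharp \<nu> = sharp \<nu>\<^sub>0"
    and neq: "\<nu> \<noteq> \<nu>\<^sub>0" and conj_neq: "conj_character \<nu> \<noteq> \<nu>\<^sub>0"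
begin

lemma nu0_of: "\<nu>\<^sub>0 (ext_of x) = \<nu> (ext_of x)"
  using fun_cong[OF sharp_eq, of x] by (simp add: sharp_def)

text \<open>The kernel of the average of \<open>\<rho>\<^sub>\<nu>\<close> over the Cartan subgroup against \<open>\<nu>\<^sub>0\<close>, that is, of
  the projection onto the \<open>\<nu>\<^sub>0\<close>-isotypic part.\<close>

definition proj :: "'a \<Rightarrow> 'a \<Rightarrow> complex" where
  "proj u v = (\<Sum>w\<in>UNIV - {0}. cnj (\<nu>\<^sub>0 w) * kernel w u v) / ((of_nat q)\<^sup>2 - 1)"

section \<open>The projection is a Hermitian idempotent of trace 1\<close>

lemma q2_nonzero: "(of_nat q)\<^sup>2 - 1 \<noteq> (0::complex)"
  and q1_nonzero: "of_nat q - 1 \<noteq> (0::complex)"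
  and qp1_nonzero: "of_nat q + 1 \<noteq> (0::complex)"
proof -
  show *: "of_nat q + 1 \<noteq> (0::complex)" by (metis of_nat_Suc of_nat_neq_0 add.commute)
  show **: "of_nat q - 1 \<noteq> (0::complex)" using q_pos by auto
  have "(of_nat q)\<^sup>2 - 1 = (of_nat q - 1) * (of_nat q + 1 :: complex)"
    by (simp add: power2_eq_square algebra_simps)
  then show "(of_nat q)\<^sup>2 - 1 \<noteq> (0::complex)" using * ** by simp
qed

lemma card_ext: "of_nat (card (UNIV - {0 :: 'a \<times> 'a})) = (of_nat q)\<^sup>2 - (1::complex)"
proof -
  have "card (UNIV - {0 :: 'a \<times> 'a}) = q * q - 1" by (simp add: card_Diff_singleton q_eq)
  moreover have "q * q \<ge> 1" using q_pos by (simp add: Suc_le_eq)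
  ultimately show ?thesis by (simp add: of_nat_diff power2_eq_square)
qed

text \<open>Since \<nu> and \<open>\<nu>\<^sub>0\<close> agree on the base field, the averaged
  summand is constant on classes modulo scalars. The class of 1 yields the delta, the other classes
  the sum over \<gamma>.\<close>

lemma proj_eq:
  "proj u v = (of_bool (u = v) + (\<Sum>\<gamma>\<in>UNIV. cnj (\<nu>\<^sub>0 (\<gamma>, 1)) * kernel (\<gamma>, 1) u v)) / (of_nat q + 1)"
proof -
  have inv: "cnj (\<nu>\<^sub>0 (ext_of b \<odot> w)) * kernel (ext_of b \<odot> w) u v = cnj (\<nu>\<^sub>0 w) * kernel w u v"
    if "b \<noteq> 0" for b w
    using that by (simp add: kernel_scale nu0.nu_mult nu0_of cnj_nu)
  have "(of_nat q)\<^sup>2 - 1 = (of_nat q - 1) * (of_nat q + 1 :: complex)"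
    by (simp add: power2_eq_square algebra_simps)
  then show ?thesis
    using sum_polar_invariant[of "\<lambda>w. cnj (\<nu>\<^sub>0 w) * kernel w u v", OF inv] q1_nonzero
    by (simp add: proj_def kernel_of)
qed

text \<open>Conjugation inverts the group element in both factors, and inversion permutes the
  summation range.\<close>

lemma cnj_proj:
  assumes "u \<noteq> 0" "v \<noteq> 0"
  shows "cnj (proj u v) = proj v u"
proof -
  have "cnj (\<Sum>w\<in>UNIV - {0}. cnj (\<nu>\<^sub>0 w) * kernel w u v)
      = (\<Sum>w\<in>UNIV - {0}. cnj (\<nu>\<^sub>0 (einv w)) * kernel (einv w) v u)"
    using assms by (simp add: cnj_kernel nu0.cnj_nu nu0.nu_einv)
  also have "\<dots> = (\<Sum>w\<in>UNIV - {0}. cnj (\<nu>\<^sub>0 w) * kernel w v u)"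
    by (rule sum.reindex_bij_witness[of _ einv einv]) (auto simp: einv_einv)
  finally show ?thesis by (simp add: proj_def)
qed

text \<open>The columns of \<open>proj\<close> are eigenvectors for \<open>\<nu>\<^sub>0\<close>:
  composing with \<open>z\<close> merely translates the average.\<close>

lemma kernel_proj:
  assumes z: "z \<noteq> 0" and u: "u \<noteq> 0" and t: "t \<noteq> 0"
  shows "(\<Sum>v\<in>UNIV - {0}. kernel z u v * proj v t) = \<nu>\<^sub>0 z * proj u t"
proof -
  have "(\<Sum>v\<in>UNIV - {0}. kernel z u v * (\<Sum>w\<in>UNIV - {0}. cnj (\<nu>\<^sub>0 w) * kernel w v t))
      = (\<Sum>w\<in>UNIV - {0}. cnj (\<nu>\<^sub>0 w) * (\<Sum>v\<in>UNIV - {0}. kernel z u v * kernel w v t))"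
    unfolding sum_distrib_left by (subst sum.swap) (simp add: mult_ac)
  also have "\<dots> = (\<Sum>w\<in>UNIV - {0}. cnj (\<nu>\<^sub>0 w) * kernel (z \<odot> w) u t)"
    by (intro sum.cong) (simp_all add: kernel_mult[OF indecomposable z _ u t])
  also have "\<dots> = (\<Sum>w\<in>UNIV - {0}. \<nu>\<^sub>0 z * (cnj (\<nu>\<^sub>0 (z \<odot> w)) * kernel (z \<odot> w) u t))"
    using z by (intro sum.cong) (simp_all add: nu0.nu_mult nu0.cnj_nu)
  also have "\<dots> = \<nu>\<^sub>0 z * (\<Sum>w\<in>UNIV - {0}. cnj (\<nu>\<^sub>0 w) * kernel w u t)"
    unfolding sum_distrib_left[symmetric] by (subst sum_mult_shift[OF z]) simp
  finally show ?thesis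
    by (simp add: proj_def sum_divide_distrib[symmetric])
qed

text \<open>On an eigenvector each term of the average returns the same value, because
  \<open>cnj (\<nu>\<^sub>0 w)\<close> cancels the eigenvalue.\<close>

lemma proj_fixes:
  assumes "\<And>w. w \<noteq> 0 \<Longrightarrow> (\<Sum>v\<in>UNIV - {0}. kernel w u v * f v) = \<nu>\<^sub>0 w * f u"
  shows "(\<Sum>v\<in>UNIV - {0}. proj u v * f v) = f u"
proof -
  have "(\<Sum>v\<in>UNIV - {0}. (\<Sum>w\<in>UNIV - {0}. cnj (\<nu>\<^sub>0 w) * kernel w u v) * f v)
      = (\<Sum>w\<in>UNIV - {0}. cnj (\<nu>\<^sub>0 w) * (\<Sum>v\<in>UNIV - {0}. kernel w u v * f v))"
    unfolding sum_distrib_left sum_distrib_right by (subst sum.swap) (simp add: mult_ac)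
  also have "\<dots> = (\<Sum>w\<in>UNIV - {0 :: 'a \<times> 'a}. f u)"
    using assms by (intro sum.cong) (simp_all add: nu0.cnj_nu)
  also have "\<dots> = ((of_nat q)\<^sup>2 - 1) * f u"
    by (simp only: sum_constant card_ext)
  finally show ?thesis
    using q2_nonzero by (simp add: proj_def sum_divide_distrib[symmetric])
qed

lemma proj_idem:
  assumes "u \<noteq> 0" "t \<noteq> 0"
  shows "(\<Sum>v\<in>UNIV - {0}. proj u v * proj v t) = proj u t"
  using proj_fixes[of u "\<lambda>v. proj v t"] kernel_proj assms by simp

text \<open>Orthogonality of the two characters, summed over classes modulo scalars: the class of 1
  contributes 1, which the slopes must cancel.\<close>

lemma slope_correlation:
  assumes \<mu>: "\<mu> \<in> ext_characters \<eta>" and "\<mu> \<noteq> \<nu>\<^sub>0" and of: "\<And>x. \<mu> (ext_of x) = \<nu>\<^sub>0 (ext_of x)"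
  shows "(\<Sum>\<gamma>\<in>UNIV. cnj (\<nu>\<^sub>0 (\<gamma>, 1)) * \<mu> (\<gamma>, 1)) = - 1"
proof -
  interpret \<mu>: ext_character \<eta> chi q \<mu> by unfold_locales (rule \<mu>)
  have "0 = (\<Sum>w\<in>UNIV - {0}. cnj (\<nu>\<^sub>0 w) * \<mu> w)"
    by (rule ext_character_orthogonality[OF \<mu> nu0.nu assms(2), symmetric])
  also have "\<dots> = (of_nat q - 1) * (cnj (\<nu>\<^sub>0 (ext_of 1)) * \<mu> (ext_of 1)
      + (\<Sum>\<gamma>\<in>UNIV. cnj (\<nu>\<^sub>0 (\<gamma>, 1)) * \<mu> (\<gamma>, 1)))"
    by (rule sum_polar_invariant) (simp add: nu0.nu_mult \<mu>.nu_mult of nu0.cnj_nu)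
  finally show ?thesis
    using q1_nonzero by (simp add: add_eq_0_iff)
qed

lemma conj_character_mem: "conj_character \<nu> \<in> ext_characters \<eta>"
proof -
  have "ext_conj (w \<odot> z) = ext_conj w \<odot> ext_conj z" for w z :: "'a \<times> 'a"
    by (simp add: ext_conj_def ext_mult_def)
  then show ?thesis
    by (auto simp: ext_characters_def characters_def conj_character_def nu_mult norm_nu)
qed

text \<open>This is multiplicity one. The diagonal delta contributes q - 1, and \<nu> and its
  conjugate, both different from \<open>\<nu>\<^sub>0\<close>, contribute 1 each; the total is the
  denominator q + 1.\<close>

lemma proj_trace: "(\<Sum>u\<in>UNIV - {0}. proj u u) = 1"
proof -
  have "(\<Sum>u\<in>UNIV - {0}. \<Sum>\<gamma>\<in>UNIV. cnj (\<nu>\<^sub>0 (\<gamma>, 1)) * kernel (\<gamma>, 1) u u)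
      = (\<Sum>\<gamma>\<in>UNIV. cnj (\<nu>\<^sub>0 (\<gamma>, 1)) * - (\<nu> (\<gamma>, 1) + conj_character \<nu> (\<gamma>, 1)))"
    by (subst sum.swap) (simp add: sum_distrib_left[symmetric] kernel_trace[OF indecomposable]
      conj_character_def ext_conj_def)
  also have "\<dots> = - (\<Sum>\<gamma>\<in>UNIV. cnj (\<nu>\<^sub>0 (\<gamma>, 1)) * \<nu> (\<gamma>, 1))
      - (\<Sum>\<gamma>\<in>UNIV. cnj (\<nu>\<^sub>0 (\<gamma>, 1)) * conj_character \<nu> (\<gamma>, 1))"
    unfolding sum_negf[symmetric] sum_subtractf[symmetric] by (simp add: algebra_simps)
  also have "(\<Sum>\<gamma>\<in>UNIV. cnj (\<nu>\<^sub>0 (\<gamma>, 1)) * \<nu> (\<gamma>, 1)) = - 1"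
    by (rule slope_correlation[OF nu neq]) (simp add: nu0_of)
  also have "(\<Sum>\<gamma>\<in>UNIV. cnj (\<nu>\<^sub>0 (\<gamma>, 1)) * conj_character \<nu> (\<gamma>, 1)) = - 1"
    by (rule slope_correlation[OF conj_character_mem conj_neq])
      (simp add: nu0_of conj_character_def, simp add: ext_conj_def ext_of_def)
  finally have "(\<Sum>u\<in>UNIV - {0}. of_bool (u = u) + (\<Sum>\<gamma>\<in>UNIV. cnj (\<nu>\<^sub>0 (\<gamma>, 1)) * kernel (\<gamma>, 1) u u))
      = of_nat (card (UNIV - {0 :: 'a})) + 2"
    by (simp add: sum.distrib)
  also have "card (UNIV - {0 :: 'a}) = q - 1"
    by (simp add: card_Diff_singleton q_eq)
  also have "of_nat (q - 1) + 2 = (of_nat q + 1 :: complex)"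
    using q_pos by (simp add: of_nat_diff)
  finally show ?thesis
    using qp1_nonzero by (simp add: proj_eq sum_divide_distrib[symmetric])
qed

section \<open>Spherical vectors and the spherical function\<close>

lemma spherical_vector_rep:
  assumes "spherical_vector \<eta> chi \<nu>\<^sub>0 \<nu> f" and "w \<noteq> 0"
  shows "cuspidal_rep \<eta> chi \<nu> (cartan_mat \<eta> w) f = (\<lambda>y. \<nu>\<^sub>0 w * f y)"
  using assms unfolding spherical_vector_def by blast

lemma spherical_vector_kernel:
  assumes "spherical_vector \<eta> chi \<nu>\<^sub>0 \<nu> f" and "w \<noteq> 0" and "u \<noteq> 0"
  shows "(\<Sum>v\<in>UNIV - {0}. kernel w u v * f v) = \<nu>\<^sub>0 w * f u"
  using cuspidal_rep_cartan[OF assms(3), of w f] spherical_vector_rep[OF assms(1,2)] by simp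

lemma proj_spherical:
  assumes f: "spherical_vector \<eta> chi \<nu>\<^sub>0 \<nu> f" and "u \<noteq> 0" "v \<noteq> 0"
  shows "proj u v = f u * cnj (f v)"
proof (rule rank_one_projection[where U = "UNIV - {0}" and P = proj and f = f])
  show "(\<Sum>u\<in>UNIV - {0}. f u * cnj (f u)) = 1"
    using f by (simp add: spherical_vector_def L_inner_def)
  show "(\<Sum>v\<in>UNIV - {0}. proj u v * f v) = f u" if "u \<in> UNIV - {0}" for u
    using that spherical_vector_kernel[OF f] by (intro proj_fixes) auto
qed (use assms cnj_proj proj_idem proj_trace in auto)

text \<open>As the trace is nonzero, some diagonal entry of \<open>proj\<close> is nonzero; the
  column through it is a nonzero eigenvector and is normalised.\<close>

lemma spherical_vector_exists: "\<exists>f. spherical_vector \<eta> chi \<nu>\<^sub>0 \<nu> f"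
proof -
  obtain t where t: "t \<noteq> 0" "proj t t \<noteq> 0"
    using proj_trace by (metis (no_types, lifting) DiffD2 insertI1 sum.neutral zero_neq_one)
  define n where "n = (\<Sum>v\<in>UNIV - {0}. (cmod (proj v t))\<^sup>2)"
  have "n \<ge> (cmod (proj t t))\<^sup>2"
    unfolding n_def by (rule member_le_sum) (use t in auto)
  then have n: "n > 0"
    using t(2) by (metis less_le_trans zero_less_norm_iff zero_less_power)
  define f where "f y = (if y = 0 then 0 else proj y t / of_real (sqrt n))" for y
  have "L_inner f f = (\<Sum>v\<in>UNIV - {0}. of_real ((cmod (proj v t))\<^sup>2 / n))"
    unfolding L_inner_def
  proof (rule sum.cong)
    fix v :: 'a assume "v \<in> UNIV - {0}"
    then have "f v * cnj (f v) = of_real ((cmod (f v))\<^sup>2)" "cmod (f v) = cmod (proj v t) / sqrt n"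
      using n by (simp_all only: complex_norm_square) (simp add: f_def norm_divide)
    then show "f v * cnj (f v) = of_real ((cmod (proj v t))\<^sup>2 / n)"
      using n by (simp add: power_divide)
  qed simp
  also have "\<dots> = of_real (n / n)"
    unfolding of_real_sum[symmetric] sum_divide_distrib[symmetric] n_def ..
  finally have "L_inner f f = 1" using n by simp
  moreover have "cuspidal_rep \<eta> chi \<nu> (cartan_mat \<eta> w) f = (\<lambda>y. \<nu>\<^sub>0 w * f y)" if w: "w \<noteq> 0" for w
  proof
    fix y
    show "cuspidal_rep \<eta> chi \<nu> (cartan_mat \<eta> w) f y = \<nu>\<^sub>0 w * f y"
    proof (cases "y = 0")
      case True
      then show ?thesis by (simp add: cuspidal_rep_def f_def Let_def)
    next
      case False
      have "(\<Sum>v\<in>UNIV - {0}. kernel w y v * f v)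
          = (\<Sum>v\<in>UNIV - {0}. kernel w y v * proj v t) / of_real (sqrt n)"
        unfolding sum_divide_distrib by (intro sum.cong) (auto simp: f_def)
      also have "\<dots> = \<nu>\<^sub>0 w * f y"
        unfolding kernel_proj[OF w False t(1)] using False by (simp add: f_def)
      finally show ?thesis using cuspidal_rep_cartan[OF False] by simp
    qed
  qed
  ultimately show ?thesis
    unfolding spherical_vector_def by (intro exI[of _ f]) (simp add: L_star_def f_def)
qed

lemma cuspidal_rep_scale: "cuspidal_rep \<eta> chi \<nu> g (\<lambda>y. c * f y) y = c * cuspidal_rep \<eta> chi \<nu> g f y"
  by (simp add: cuspidal_rep_def Let_def sum_distrib_left mult_ac)

lemma spherical_vector_unique:
  assumes f: "spherical_vector \<eta> chi \<nu>\<^sub>0 \<nu> f" and h: "spherical_vector \<eta> chi \<nu>\<^sub>0 \<nu> h"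
  shows "\<exists>c. cnj c * c = 1 \<and> h = (\<lambda>y. c * f y)"
proof -
  have "L_inner h h = 1" using h by (simp add: spherical_vector_def)
  then obtain t where t: "t \<noteq> 0" "h t \<noteq> 0"
    unfolding L_inner_def by (metis (no_types, lifting) DiffD2 insertI1 mult_zero_left sum.neutral zero_neq_one)
  \<comment> \<open>Forced by comparing column \<open>t\<close> of \<open>proj\<close> as expressed
    through \<open>f\<close> and through \<open>h\<close>.\<close>
  define c where "c = cnj (f t) / cnj (h t)"
  have "h y = c * f y" for y
  proof (cases "y = 0")
    case True
    then show ?thesis using f h by (simp add: spherical_vector_def L_star_def)
  next
    case False
    then have "h y * cnj (h t) = f y * cnj (f t)"
      using proj_spherical[OF f False t(1)] proj_spherical[OF h False t(1)] by simp
    then show ?thesis using t(2) by (simp add: c_def field_simps)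
  qed
  then have hf: "h = (\<lambda>y. c * f y)" ..
  have "L_inner h h = (cnj c * c) * L_inner f f"
    by (simp add: hf L_inner_def sum_distrib_left mult_ac)
  then have "cnj c * c = 1" using f h by (simp add: spherical_vector_def)
  then show ?thesis using hf by blast
qed

text \<open>Two spherical vectors differ by a factor \<open>c\<close>, and the matrix coefficient
  changes by \<open>cnj c * c = 1\<close>; hence the description is unique.\<close>

lemma spherical_function_eq:
  assumes f: "spherical_vector \<eta> chi \<nu>\<^sub>0 \<nu> f"
  shows "spherical_function \<eta> chi \<nu>\<^sub>0 \<nu>
    = (\<lambda>g. if g \<in> GL2 then L_inner f (cuspidal_rep \<eta> chi \<nu> g f) else 0)"
  unfolding spherical_function_def
proof (rule the_equality)
  fix \<phi> assume "\<exists>h. spherical_vector \<eta> chi \<nu>\<^sub>0 \<nu> h \<and>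
    \<phi> = (\<lambda>g. if g \<in> GL2 then L_inner h (cuspidal_rep \<eta> chi \<nu> g h) else 0)"
  then obtain h where h: "spherical_vector \<eta> chi \<nu>\<^sub>0 \<nu> h"
    and \<phi>: "\<phi> = (\<lambda>g. if g \<in> GL2 then L_inner h (cuspidal_rep \<eta> chi \<nu> g h) else 0)" by blast
  obtain c where c: "cnj c * c = 1" "h = (\<lambda>y. c * f y)"
    using spherical_vector_unique[OF f h] by blast
  have "L_inner h (cuspidal_rep \<eta> chi \<nu> g h) = (cnj c * c) * L_inner f (cuspidal_rep \<eta> chi \<nu> g f)" for g
    unfolding c(2) L_inner_def cuspidal_rep_scale by (simp add: sum_distrib_left mult_ac)
  then show "\<phi> = (\<lambda>g. if g \<in> GL2 then L_inner f (cuspidal_rep \<eta> chi \<nu> g f) else 0)"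
    unfolding \<phi> using c(1) by (intro ext) simp
qed (use f in blast)

text \<open>Multiplicativity of the representation for a left factor from the affine group, which
  acts by a phase and a dilation. It is read off the defining formulas, the determinant
  \<open>x * N w\<close> being absorbed by the dilation.\<close>

lemma cuspidal_rep_affine_cartan:
  assumes x: "x \<noteq> 0" and w: "w \<noteq> 0" and u: "u \<noteq> 0"
  shows "cuspidal_rep \<eta> chi \<nu> (mat2 x y 0 1 ** cartan_mat \<eta> w) f u
    = chi (y / u) * cuspidal_rep \<eta> chi \<nu> (cartan_mat \<eta> w) f (u / x)"
proof -
  obtain a b where ab: "w = (a, b)" by (cases w)
  have mat: "mat2 x y 0 1 ** cartan_mat \<eta> w = mat2 (x * a + y * b) (x * (\<eta> * b) + y * a) b a"
    by (simp add: ab cartan_mat_def mat2_def matrix_matrix_mult_def vec_eq_iff forall_2 sum_2)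
  show ?thesis
  proof (cases "b = 0")
    case True
    then have "a \<noteq> 0" using w by (simp add: ab zero_prod_def)
    then have "inverse a * (y * a) * inverse u = y / u" "a * inverse (x * a) * u = u / x"
      using u x by (simp_all add: field_simps)
    then show ?thesis
      unfolding mat using u x True \<open>a \<noteq> 0\<close>
      by (simp add: cuspidal_rep_def Let_def mat2_def cartan_mat_def ab vector_2)
  next
    case False
    have d1: "det (mat2 (x * a + y * b) (x * (\<eta> * b) + y * a) b a) = x * N w"
      by (simp add: mat2_def det_2 ext_norm_eq ab power2_eq_square algebra_simps)
    have d2: "det (cartan_mat \<eta> w) = N w"
      by (simp add: cartan_mat_def mat2_def det_2 ext_norm_eq ab power2_eq_square)
    have j_arg: "inverse (b\<^sup>2) * inverse u * inverse v * (x * N w)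
        = inverse (b\<^sup>2) * inverse (u / x) * inverse v * N w" for v
      by (simp add: divide_inverse mult_ac)
    have "(x * a + y * b) * inverse b * inverse u + inverse b * a * inverse v
        = y / u + (a * inverse b * inverse (u / x) + inverse b * a * inverse v)" for v
      using False by (simp add: divide_inverse algebra_simps)
    then have chi_arg: "chi ((x * a + y * b) * inverse b * inverse u + inverse b * a * inverse v)
        = chi (y / u) * chi (a * inverse b * inverse (u / x) + inverse b * a * inverse v)" for v
      by (simp only: chi_add)
    have entries: "mat2 p r s t $ 1 $ 1 = p" "mat2 p r s t $ 1 $ 2 = r"
      "mat2 p r s t $ 2 $ 1 = s" "mat2 p r s t $ 2 $ 2 = t" for p r s t :: 'a
      by (simp_all add: mat2_def vector_2)
    have "u / x \<noteq> 0" using u x by simp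
    then show ?thesis
      unfolding mat cuspidal_rep_def Let_def d1 d2
      unfolding cartan_mat_def entries ab fst_conv snd_conv
      unfolding ab[symmetric] j_arg chi_arg
      using u False by (simp add: sum_distrib_left mult_ac)
  qed
qed

text \<open>The spherical vector enters only through products \<open>f u * cnj (f (u / x))\<close>,
  and these are entries of \<open>proj\<close>, so no explicit spherical vector is required.\<close>

theorem spherical_function_formula:
  assumes x: "x \<noteq> 0" and w: "w \<noteq> 0"
  shows "spherical_function \<eta> chi \<nu>\<^sub>0 \<nu> (mat2 x y 0 1 ** cartan_mat \<eta> w)
    = cnj (\<nu>\<^sub>0 w) * (\<Sum>u\<in>UNIV - {0}. chi (- y / u) * proj u (u / x))"
proof -
  obtain f where f: "spherical_vector \<eta> chi \<nu>\<^sub>0 \<nu> f" using spherical_vector_exists by blast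
  have "det (mat2 x y 0 1) = x" "det (cartan_mat \<eta> w) = N w"
    by (simp_all add: cartan_mat_def mat2_def det_2 ext_norm_eq power2_eq_square)
  then have "mat2 x y 0 1 ** cartan_mat \<eta> w \<in> GL2"
    using x w by (simp add: GL2_def invertible_det_nz det_mul)
  then have "spherical_function \<eta> chi \<nu>\<^sub>0 \<nu> (mat2 x y 0 1 ** cartan_mat \<eta> w)
      = (\<Sum>u\<in>UNIV - {0}. f u * cnj (chi (y / u) * (\<nu>\<^sub>0 w * f (u / x))))"
    unfolding spherical_function_eq[OF f] L_inner_def
    using x w by (simp add: cuspidal_rep_affine_cartan spherical_vector_rep[OF f w])
  also have "\<dots> = (\<Sum>u\<in>UNIV - {0}. cnj (\<nu>\<^sub>0 w) * (chi (- y / u) * proj u (u / x)))"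
    using x by (intro sum.cong) (simp_all add: proj_spherical[OF f] chi_minus mult_ac)
  finally show ?thesis by (simp add: sum_distrib_left)
qed

end

section \<open>Insertion of the explicit projection kernel\<close>

theorem theorem6p15:
  fixes \<eta> :: "'a::{field,finite}" and q :: nat
    and chi :: "'a \<Rightarrow> complex" and \<nu>\<^sub>0 \<nu> :: "'a \<times> 'a \<Rightarrow> complex"
  assumes "q = CARD('a)" and "odd q"
    and "is_generator \<eta>"
    and "chi \<in> additive_characters" and "\<exists>t. chi t \<noteq> 1"
    and "\<nu>\<^sub>0 \<in> ext_characters \<eta>" and "\<nu> \<in> ext_characters \<eta>"
    and "\<not> decomposable \<eta> \<nu>\<^sub>0" and "\<not> decomposable \<eta> \<nu>"
    and "sharp \<nu> = sharp \<nu>\<^sub>0"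
    and "\<nu> \<noteq> \<nu>\<^sub>0" and "conj_character \<nu> \<noteq> \<nu>\<^sub>0"
  shows "\<forall>x y a b. x \<noteq> 0 \<longrightarrow> (a, b) \<noteq> (0, 0) \<longrightarrow>
    spherical_function \<eta> chi \<nu>\<^sub>0 \<nu> (mat2 x y 0 1 ** mat2 a (\<eta> * b) b a) =
      - (cnj (\<nu>\<^sub>0 (a, b)) / (of_nat q + 1)) *
        (\<Sum>z\<in>UNIV - {0}. \<nu> (ext_of (- inverse x * z)) * chi (- y * inverse z) *
          (\<Sum>\<gamma>\<in>UNIV. cnj (\<nu>\<^sub>0 (\<gamma>, 1)) * chi (\<gamma> * inverse z * (x + 1)) *
             bessel_j \<eta> chi \<nu> (x * inverse (z\<^sup>2) * (\<gamma>\<^sup>2 - \<eta>))))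
      + (cnj (\<nu>\<^sub>0 (a, b)) / (of_nat q + 1)) *
        of_bool (x = 1) * (of_nat q * of_bool (y = 0) - 1)"
proof (intro allI impI)
  interpret spherical_pair \<eta> chi q \<nu> \<nu>\<^sub>0
    by unfold_locales (use assms in auto)
  fix x y a b :: 'a
  assume x: "x \<noteq> 0" and ab: "(a, b) \<noteq> (0, 0)"
  define T where "T z = \<nu> (ext_of (- inverse x * z)) * chi (- y * inverse z) *
    (\<Sum>\<gamma>\<in>UNIV. cnj (\<nu>\<^sub>0 (\<gamma>, 1)) * chi (\<gamma> * inverse z * (x + 1)) *
       j (x * inverse (z\<^sup>2) * (\<gamma>\<^sup>2 - \<eta>)))" for z
  have summand: "chi (- y / u) * proj u (u / x)
      = (of_bool (x = 1) * chi (- y / u) - T u) / (of_nat q + 1)"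
    if u: "u \<in> UNIV - {0}" for u
  proof -
    \<comment> \<open>The identity part of \<open>proj\<close> is seen at column
      \<open>u / x\<close> only for \<open>x = 1\<close>, which is the origin of the delta in
      \<open>x\<close>.\<close>
    have diag: "u = u / x \<longleftrightarrow> x = 1" using u x by (auto simp: field_simps)
    have kern: "kernel (\<gamma>, 1) u (u / x) = - (\<nu> (ext_of (- inverse x * u)) *
        (chi (\<gamma> * inverse u * (x + 1)) * j (x * inverse (u\<^sup>2) * (\<gamma>\<^sup>2 - \<eta>))))" for \<gamma>
    proof -
      have "- (u / x) = - inverse x * u" by (simp add: divide_inverse)
      moreover have "\<gamma> * (1 / u + 1 / (u / x)) = \<gamma> * inverse u * (x + 1)"
        by (simp add: divide_inverse algebra_simps)
      moreover have "(\<gamma>\<^sup>2 - \<eta>) / (u * (u / x)) = x * inverse (u\<^sup>2) * (\<gamma>\<^sup>2 - \<eta>)"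
        by (simp add: divide_inverse power2_eq_square mult_ac)
      ultimately show ?thesis
        unfolding kernel_slope by (simp only: mult_minus_left mult.assoc)
    qed
    have "(\<Sum>\<gamma>\<in>UNIV. cnj (\<nu>\<^sub>0 (\<gamma>, 1)) * kernel (\<gamma>, 1) u (u / x)) = - (\<nu> (ext_of (- inverse x * u)) *
        (\<Sum>\<gamma>\<in>UNIV. cnj (\<nu>\<^sub>0 (\<gamma>, 1)) * chi (\<gamma> * inverse u * (x + 1)) *
          j (x * inverse (u\<^sup>2) * (\<gamma>\<^sup>2 - \<eta>))))"
      unfolding kern sum_distrib_left sum_negf[symmetric] by (simp only: mult_minus_right mult_ac)
    moreover have "- y / u = - y * inverse u" by (simp add: divide_inverse)
    moreover have "k * ((o1 + - (m * s)) / d) = (o1 * k - m * k * s) / d" for k o1 m s d :: complex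
      by (simp add: algebra_simps)
    ultimately show ?thesis
      unfolding proj_eq diag T_def by simp
  qed
  have collect: "c * ((o1 * m - S) / d) = - (c / d) * S + c / d * o1 * m" for c o1 m S d :: complex
    by (simp add: diff_divide_distrib algebra_simps)
  have "spherical_function \<eta> chi \<nu>\<^sub>0 \<nu> (mat2 x y 0 1 ** mat2 a (\<eta> * b) b a)
      = cnj (\<nu>\<^sub>0 (a, b)) * (\<Sum>u\<in>UNIV - {0}. (of_bool (x = 1) * chi (- y / u) - T u) / (of_nat q + 1))"
    using spherical_function_formula[OF x, of "(a, b)" y] ab summand
    by (simp add: cartan_mat_def zero_prod_def)
  \<comment> \<open>Summing the phase of the identity part over \<open>u\<close> gives the factor
    with the delta in \<open>y\<close>.\<close>
  also have "(\<Sum>u\<in>UNIV - {0}. (of_bool (x = 1) * chi (- y / u) - T u) / (of_nat q + 1))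
      = (of_bool (x = 1) * (of_nat q * of_bool (y = 0) - 1) - (\<Sum>u\<in>UNIV - {0}. T u)) / (of_nat q + 1)"
    unfolding sum_divide_distrib[symmetric] sum_subtractf sum_distrib_left[symmetric] sum_chi_divide
    by simp
  finally show "spherical_function \<eta> chi \<nu>\<^sub>0 \<nu> (mat2 x y 0 1 ** mat2 a (\<eta> * b) b a) =
      - (cnj (\<nu>\<^sub>0 (a, b)) / (of_nat q + 1)) * (\<Sum>z\<in>UNIV - {0}. \<nu> (ext_of (- inverse x * z)) * chi (- y * inverse z) *
          (\<Sum>\<gamma>\<in>UNIV. cnj (\<nu>\<^sub>0 (\<gamma>, 1)) * chi (\<gamma> * inverse z * (x + 1)) *
             bessel_j \<eta> chi \<nu> (x * inverse (z\<^sup>2) * (\<gamma>\<^sup>2 - \<eta>))))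
      + (cnj (\<nu>\<^sub>0 (a, b)) / (of_nat q + 1)) *
        of_bool (x = 1) * (of_nat q * of_bool (y = 0) - 1)"
    unfolding T_def[symmetric] by (simp only: collect)
qed

end
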